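(* Let $Y$ be a connected based space satisfying the standing assumptions in the context, and let $\Lambda Y = \mathrm{map}(S^1, Y; 0)$ be the null component of the free loop space of $Y$. For every $n \geq 1$ there is an isomorphism of abelian groups $$G_n(\Lambda Y) \cong G_n(Y) \oplus G_{n+1}(Y).$$
   Context: Standing assumptions: $Y$ is a based space (basepoint $y_0$) that is connected, locally compact, Hausdorff and well-pointed (no finiteness or simple connectivity is assumed, and $Y$ need not be a CW complex). Mapping spaces consist of unbased maps and carry the compact-open topology. $\mathrm{map}(S^1,Y;0)$ denotes the path component of the null (constant) map in the space of all unbased maps $S^1\to Y$, based at the constant map at $y_0$. For a based space $Z$, $\mathrm{aut}_1 Z$ denotes the path component of the identity map $1_Z$ in the space of unbased self-maps of $Z$ (i.e. the maps freely homotopic to the identity), based at $1_Z$, and $\omega\colon \mathrm{aut}_1 Z\to Z$ is evaluation at the basepoint of $Z$. The $n$th Gottlieb group $G_n(Z)$ ($n\ge 1$) is the image of $\omega_\#\colon \pi_n(\mathrm{aut}_1 Z)\to \pi_n(Z)$; it is always abelian.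
   Formalization: "Connected" is taken to mean path connected; for merely topologically connected Y the claim fails, e.g. for the closed topologist's sine curve wedged with a circle at its free end, where G_1(ΛY) = Z but G_1(Y) = G_2(Y) = 0. *)

theory Defs
  imports "HOL-Analysis.Analysis" "HOL-Algebra.Group"
begin

text \<open>Maps are represented by functions that are extensional outside the domain, so that the
  points of the mapping space are exactly the continuous maps. Taking the empty compact set below
  gives the whole space, hence the underlying set is indeed the set of all such maps.\<close>

definition maps :: "'a topology \<Rightarrow> 'b topology \<Rightarrow> ('a \<Rightarrow> 'b) set" where
  "maps X Y = {f \<in> extensional (topspace X). continuous_map X Y f}"

definition map_space :: "'a topology \<Rightarrow> 'b topology \<Rightarrow> ('a \<Rightarrow> 'b) topology" where
  "map_space X Y = topology_generated_by
     {{f \<in> maps X Y. f ` K \<subseteq> U} |K U. compactin X K \<and> openin Y U}"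

lemma topspace_map_space [simp]: "topspace (map_space X Y) = maps X Y"
proof -
  have "maps X Y = {f \<in> maps X Y. f ` {} \<subseteq> {}}" by simp
  moreover have "compactin X {}" "openin Y {}" by auto
  ultimately show ?thesis
    unfolding map_space_def topology_generated_by_topspace by blast
qed

definition path_component_space :: "'a topology \<Rightarrow> 'a \<Rightarrow> 'a topology" where
  "path_component_space X x = subtopology X (path_component_of_set X x)"

definition const_map :: "'a topology \<Rightarrow> 'b \<Rightarrow> 'a \<Rightarrow> 'b" where
  "const_map X y = (\<lambda>x\<in>topspace X. y)"

definition id_map :: "'a topology \<Rightarrow> 'a \<Rightarrow> 'a" where
  "id_map X = (\<lambda>x\<in>topspace X. x)"

abbreviation circle :: "complex topology" where
  "circle \<equiv> top_of_set (sphere 0 1)"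

definition null_loop_space :: "'a topology \<Rightarrow> 'a \<Rightarrow> (complex \<Rightarrow> 'a) topology" where
  "null_loop_space Y y0 = path_component_space (map_space circle Y) (const_map circle y0)"

definition aut1 :: "'a topology \<Rightarrow> ('a \<Rightarrow> 'a) topology" where
  "aut1 Z = path_component_space (map_space Z Z) (id_map Z)"

definition has_hep :: "'a topology \<Rightarrow> 'a set \<Rightarrow> 'b topology \<Rightarrow> bool" where
  "has_hep X A W \<longleftrightarrow>
     (\<forall>f h. continuous_map X W f \<and>
            continuous_map (prod_topology (top_of_set {0..1::real}) (subtopology X A)) W h \<and>
            (\<forall>a \<in> topspace X \<inter> A. h (0, a) = f a) \<longrightarrow>
        (\<exists>H. continuous_map (prod_topology (top_of_set {0..1::real}) X) W H \<and>
             (\<forall>x \<in> topspace X. H (0, x) = f x) \<and>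
             (\<forall>t \<in> {0..1}. \<forall>a \<in> topspace X \<inter> A. H (t, a) = h (t, a))))"

text \<open>The inclusion of the base point is a cofibration. The homotopy extension property has to be
  required for all target spaces; one cannot quantify over types here, but spaces carried by
  \<^typ>\<open>real \<times> 'a\<close> suffice, since the universal target, the mapping cylinder of the inclusion, is
  among them. The lemma \<open>well_pointed_has_hep\<close> confirms this.\<close>

definition well_pointed :: "'a topology \<Rightarrow> 'a \<Rightarrow> bool" where
  "well_pointed X x0 \<longleftrightarrow>
     x0 \<in> topspace X \<and> (\<forall>W :: (real \<times> 'a) topology. has_hep X {x0} W)"

lemma well_pointed_has_hep:
  fixes X :: "'a topology" and W :: "'b topology"
  assumes wp: "well_pointed X x0" and closed: "closedin X {x0}"
  shows "has_hep X {x0} W"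
  unfolding has_hep_def
proof (intro allI impI, elim conjE)
  fix f h
  let ?I = "top_of_set {0..1::real}"
  let ?P = "prod_topology ?I X"
  assume f: "continuous_map X W f"
    and h: "continuous_map (prod_topology ?I (subtopology X {x0})) W h"
    and hf: "\<forall>a \<in> topspace X \<inter> {x0}. h (0, a) = f a"
  have x0: "x0 \<in> topspace X" using wp by (simp add: well_pointed_def)
  define S where "S = {0::real} \<times> topspace X"
  define T where "T = {0..1::real} \<times> {x0}"
  define M where "M = subtopology ?P (S \<union> T)"
  have clS: "closedin ?P S" and clT: "closedin ?P T"
    unfolding S_def T_def using closed by (auto simp: closedin_prod_Times_iff)
  have topM: "topspace M = S \<union> T"
    unfolding M_def S_def T_def using x0 by auto
  have PT: "prod_topology ?I (subtopology X {x0}) = subtopology ?P T"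
    unfolding T_def subtopology_Times by (simp only: subtopology_subtopology Int_absorb)
  have "has_hep X {x0} M" using wp by (simp add: well_pointed_def)
  moreover have "continuous_map X M (\<lambda>x. (0, x))"
    unfolding M_def by (auto simp: continuous_map_in_subtopology continuous_map_pairwise o_def S_def)
  moreover have "continuous_map (prod_topology ?I (subtopology X {x0})) M (\<lambda>p. p)"
  proof -
    from PT have "continuous_map (prod_topology ?I (subtopology X {x0})) ?P (\<lambda>p. p)"
      by (simp add: continuous_map_from_subtopology)
    then show ?thesis
      unfolding M_def by (auto simp: continuous_map_in_subtopology T_def)
  qed
  ultimately have "\<exists>r. continuous_map ?P M r \<and> (\<forall>x \<in> topspace X. r (0, x) = (0, x)) \<and>
      (\<forall>t \<in> {0..1}. \<forall>a \<in> topspace X \<inter> {x0}. r (t, a) = (t, a))"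
    unfolding has_hep_def by blast
  then obtain r where r: "continuous_map ?P M r"
    and r0: "\<And>x. x \<in> topspace X \<Longrightarrow> r (0, x) = (0, x)"
    and r1: "\<And>t. t \<in> {0..1} \<Longrightarrow> r (t, x0) = (t, x0)"
    using x0 by blast
  define g where "g = (\<lambda>p. if p \<in> S then f (snd p) else h p)"
  have gS: "continuous_map (subtopology M S) W g"
  proof (rule continuous_map_eq)
    show "continuous_map (subtopology M S) W (f \<circ> snd)"
      unfolding M_def subtopology_subtopology
      by (intro continuous_map_compose[OF _ f] continuous_map_from_subtopology continuous_map_snd)
  qed (auto simp: g_def)
  have gT: "continuous_map (subtopology M T) W g"
  proof (rule continuous_map_eq)
    have "subtopology M T = prod_topology ?I (subtopology X {x0})"
      unfolding M_def subtopology_subtopology PT by (simp add: Int_absorb1)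
    then show "continuous_map (subtopology M T) W h" using h by simp
  qed (use hf x0 in \<open>auto simp: g_def S_def T_def\<close>)
  have "continuous_map M W g"
  proof (rule pasting_lemma_closed[of "{S, T}" M "\<lambda>i. i" W "\<lambda>_. g" g])
    show "closedin M i" if "i \<in> {S, T}" for i
      using that clS clT unfolding M_def by (auto intro: closedin_subset_topspace)
  qed (use gS gT topM in auto)
  with r have "continuous_map ?P W (g \<circ> r)" by (rule continuous_map_compose)
  moreover have "\<forall>x \<in> topspace X. (g \<circ> r) (0, x) = f x"
    using r0 by (simp add: g_def S_def)
  moreover have "\<forall>t \<in> {0..1}. \<forall>a \<in> topspace X \<inter> {x0}. (g \<circ> r) (t, a) = h (t, a)"
    using r1 hf x0 by (auto simp: g_def S_def)
  ultimately show "\<exists>H. continuous_map ?P W H \<and> (\<forall>x \<in> topspace X. H (0, x) = f x) \<and>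
      (\<forall>t \<in> {0..1}. \<forall>a \<in> topspace X \<inter> {x0}. H (t, a) = h (t, a))"
    by blast
qed

definition cube :: "nat \<Rightarrow> (nat \<Rightarrow> real) topology" where
  "cube n = product_topology (\<lambda>_. top_of_set {0..1}) {..<n}"

definition cube_boundary :: "nat \<Rightarrow> (nat \<Rightarrow> real) set" where
  "cube_boundary n = {s \<in> topspace (cube n). \<exists>i<n. s i = 0 \<or> s i = 1}"

definition spheroids :: "nat \<Rightarrow> 'a topology \<Rightarrow> 'a \<Rightarrow> ((nat \<Rightarrow> real) \<Rightarrow> 'a) set" where
  "spheroids n X x0 = {f \<in> maps (cube n) X. \<forall>s \<in> cube_boundary n. f s = x0}"

definition htpy_class ::
    "nat \<Rightarrow> 'a topology \<Rightarrow> 'a \<Rightarrow> ((nat \<Rightarrow> real) \<Rightarrow> 'a) \<Rightarrow> ((nat \<Rightarrow> real) \<Rightarrow> 'a) set" where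
  "htpy_class n X x0 f = {g \<in> spheroids n X x0.
     homotopic_with (\<lambda>h. \<forall>s \<in> cube_boundary n. h s = x0) (cube n) X f g}"

definition spheroid_concat ::
    "nat \<Rightarrow> ((nat \<Rightarrow> real) \<Rightarrow> 'a) \<Rightarrow> ((nat \<Rightarrow> real) \<Rightarrow> 'a) \<Rightarrow> (nat \<Rightarrow> real) \<Rightarrow> 'a" where
  "spheroid_concat n f g = (\<lambda>s\<in>topspace (cube n).
     if s 0 \<le> 1/2 then f (s(0 := 2 * s 0)) else g (s(0 := 2 * s 0 - 1)))"

text \<open>Meaningful for \<open>n \<ge> 1\<close>. The unions below are unions of one and the same class, since the
  operations respect homotopy; this avoids choosing representatives.\<close>

definition homotopy_group ::
    "nat \<Rightarrow> 'a topology \<Rightarrow> 'a \<Rightarrow> ((nat \<Rightarrow> real) \<Rightarrow> 'a) set monoid" where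
  "homotopy_group n X x0 =
     \<lparr>carrier = htpy_class n X x0 ` spheroids n X x0,
      mult = (\<lambda>A B. \<Union>f\<in>A. \<Union>g\<in>B. htpy_class n X x0 (spheroid_concat n f g)),
      one = htpy_class n X x0 (const_map (cube n) x0)\<rparr>"

definition induced_hom ::
    "nat \<Rightarrow> 'b topology \<Rightarrow> 'b \<Rightarrow> ('a \<Rightarrow> 'b)
       \<Rightarrow> ((nat \<Rightarrow> real) \<Rightarrow> 'a) set \<Rightarrow> ((nat \<Rightarrow> real) \<Rightarrow> 'b) set" where
  "induced_hom n Y y0 \<phi> A =
     (\<Union>f\<in>A. htpy_class n Y y0 (restrict (\<phi> \<circ> f) (topspace (cube n))))"

definition gottlieb_group ::
    "nat \<Rightarrow> 'a topology \<Rightarrow> 'a \<Rightarrow> ((nat \<Rightarrow> real) \<Rightarrow> 'a) set monoid" where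
  "gottlieb_group n Z z0 = (homotopy_group n Z z0)
     \<lparr>carrier := induced_hom n Z z0 (\<lambda>g. g z0) ` carrier (homotopy_group n (aut1 Z) (id_map Z))\<rparr>"

end

theory Submission
  imports Defs "HOL-Algebra.Coset"
begin

text \<open>Write \<open>L X\<close> for the space of all free loops in \<open>X\<close>, and \<open>M\<close> for the space of self-maps of
  \<open>Y\<close>, based at the identity. The theorem rests on three facts.

  First, for every space \<open>X\<close> and \<open>n \<ge> 1\<close> each element of \<open>\<pi>\<^sub>n (L X)\<close> is uniquely a product
  \<open>c a \<cdot> j b\<close> with \<open>a\<close> in \<open>\<pi>\<^sub>n X\<close> and \<open>b\<close> in \<open>\<pi>\<^sub>n\<^sub>+\<^sub>1 X\<close>. Here \<open>c\<close> comes from the constant loops, and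
  \<open>j\<close> reads the last coordinate of a cube as the loop parameter. Evaluating loops at 1 is a
  left inverse of \<open>c\<close>, and its kernel is the injective image of \<open>j\<close>
  (\<open>loop_spheroid_exact\<close>, \<open>loop_spheroid_inj\<close>, \<open>loop_space_decomposition\<close>).

  Second, the Gottlieb group of the null component of \<open>L Y\<close> is the image of \<open>\<pi>\<^sub>n (L M)\<close> under
  evaluation of self-maps at \<open>y0\<close> (\<open>gottlieb_null_loop_carrier\<close>). A family of self-maps of the null
  component gives, by restriction to the constant loops, a family of loops of self-maps of \<open>Y\<close>;
  conversely a loop of self-maps of \<open>Y\<close> acts on loops in \<open>Y\<close> point by point. The space of loops
  is in general not locally compact, so that the exponential law may fail for it. The argument
  therefore passes to adjoints only over \<open>Y\<close>, the circle and cubes.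

  Third, Gottlieb elements commute with all elements of the homotopy group (\<open>gottlieb_central\<close>).

  Applying the decomposition to \<open>M\<close> and evaluating at \<open>y0\<close> shows that the Gottlieb group of the
  null component consists exactly of the products \<open>c a \<cdot> j b\<close> with \<open>a\<close> and \<open>b\<close> in the Gottlieb groups
  of \<open>Y\<close>; the decomposition for \<open>Y\<close> itself gives uniqueness of \<open>a\<close> and \<open>b\<close>, and commutativity
  makes \<open>(a, b) \<mapsto> c a \<cdot> j b\<close> a homomorphism.\<close>

section \<open>The compact-open topology\<close>

abbreviation unit_interval :: "real topology" where
  "unit_interval \<equiv> top_of_set {0..1}"

lemma maps_apply: "g \<in> maps X Y \<Longrightarrow> x \<in> topspace X \<Longrightarrow> g x \<in> topspace Y"
  by (auto simp: maps_def continuous_map_def)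

lemma restrict_in_maps:
  "continuous_map X Y g \<Longrightarrow> restrict g (topspace X) \<in> maps X Y"
  unfolding maps_def by (auto intro: continuous_map_eq)

lemma const_map_in_maps: "y \<in> topspace Y \<Longrightarrow> const_map X y \<in> maps X Y"
  unfolding const_map_def by (intro restrict_in_maps) simp

lemma id_map_in_maps: "id_map X \<in> maps X X"
  unfolding id_map_def by (intro restrict_in_maps) simp

lemmas Union_subbasis_map_space =
  topspace_map_space[unfolded map_space_def topology_generated_by_topspace]

lemma continuous_map_slice:
  assumes f: "continuous_map (prod_topology W A) Z f" and w: "w \<in> topspace W"
  shows "continuous_map A Z (\<lambda>a. f (w, a))"
proof -
  have "continuous_map A (prod_topology W A) (\<lambda>a. (w, a))"
    using w by (simp add: continuous_map_pairwise o_def)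
  from continuous_map_compose[OF this f] show ?thesis by (simp add: o_def)
qed

text \<open>One half of the exponential law, valid for all spaces: a compact set of parameters in an open set
  has a product neighbourhood there, by the tube lemma.\<close>

lemma continuous_map_curry:
  assumes f: "continuous_map (prod_topology W A) Z f"
  shows "continuous_map W (map_space A Z) (\<lambda>w. \<lambda>a\<in>topspace A. f (w, a))"
proof -
  have in_maps: "(\<lambda>a\<in>topspace A. f (w, a)) \<in> maps A Z" if "w \<in> topspace W" for w
    by (rule restrict_in_maps[OF continuous_map_slice[OF f that]])
  show ?thesis
    unfolding map_space_def
  proof (rule continuous_on_generated_topo)
    fix B assume "B \<in> {{g \<in> maps A Z. g ` K \<subseteq> U} |K U. compactin A K \<and> openin Z U}"
    then obtain K U where K: "compactin A K" and U: "openin Z U"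
      and B: "B = {g \<in> maps A Z. g ` K \<subseteq> U}" by blast
    define O' where "O' = {p \<in> topspace (prod_topology W A). f p \<in> U}"
    have O': "openin (prod_topology W A) O'"
      unfolding O'_def using f U by (rule openin_continuous_map_preimage)
    have KA: "K \<subseteq> topspace A" using K by (rule compactin_subset_topspace)
    show "openin W ((\<lambda>w. \<lambda>a\<in>topspace A. f (w, a)) -` B \<inter> topspace W)"
    proof (subst openin_subopen, intro ballI)
      fix w assume "w \<in> (\<lambda>w. \<lambda>a\<in>topspace A. f (w, a)) -` B \<inter> topspace W"
      then have w: "w \<in> topspace W" and wK: "\<And>a. a \<in> K \<Longrightarrow> f (w, a) \<in> U"
        using KA by (auto simp: B image_subset_iff subset_iff split: if_splits)
      have wK': "{w} \<times> K \<subseteq> O'" using w wK KA by (auto simp: O'_def)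
      have "compactin W {w}" using w by simp
      then obtain V V' where V: "openin W V" "{w} \<subseteq> V" "K \<subseteq> V'" "V \<times> V' \<subseteq> O'"
        by (rule Wallace_theorem_prod_topology[OF _ K O' wK'])
      have VW: "V \<subseteq> topspace W" using V(1) by (rule openin_subset)
      have "V \<subseteq> (\<lambda>w. \<lambda>a\<in>topspace A. f (w, a)) -` B \<inter> topspace W"
      proof
        fix v assume v: "v \<in> V"
        have "f (v, a) \<in> U" if "a \<in> K" for a using v that V(3,4) by (auto simp: O'_def)
        then show "v \<in> (\<lambda>w. \<lambda>a\<in>topspace A. f (w, a)) -` B \<inter> topspace W"
          using in_maps v VW KA by (auto simp: B)
      qed
      with V show "\<exists>T. openin W T \<and> w \<in> T \<and>
          T \<subseteq> (\<lambda>w. \<lambda>a\<in>topspace A. f (w, a)) -` B \<inter> topspace W" by blast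
    qed
  next
    show "(\<lambda>w. \<lambda>a\<in>topspace A. f (w, a)) ` topspace W
        \<subseteq> \<Union> {{g \<in> maps A Z. g ` K \<subseteq> U} |K U. compactin A K \<and> openin Z U}"
      unfolding Union_subbasis_map_space using in_maps by (rule image_subsetI)
  qed
qed

lemma openin_map_space_basic:
  "compactin A K \<Longrightarrow> openin Z U \<Longrightarrow> openin (map_space A Z) {g \<in> maps A Z. g ` K \<subseteq> U}"
  unfolding map_space_def by (intro topology_generated_by_Basis) blast

text \<open>The other half needs a compact neighbourhood of the argument inside the preimage of the open set,
  so that closeness in the compact-open topology controls the values on a whole neighbourhood.\<close>

lemma continuous_map_uncurry:
  assumes A: "locally_compact_space A" "Hausdorff_space A"
    and F: "continuous_map W (map_space A Z) F"
  shows "continuous_map (prod_topology W A) Z (\<lambda>p. F (fst p) (snd p))"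
  unfolding continuous_map
proof (intro conjI allI impI)
  have FW: "F w \<in> maps A Z" if "w \<in> topspace W" for w
    using F that by (auto simp: continuous_map_def)
  show "(\<lambda>p. F (fst p) (snd p)) ` topspace (prod_topology W A) \<subseteq> topspace Z"
    by (auto intro!: maps_apply[OF FW])
  fix U assume U: "openin Z U"
  show "openin (prod_topology W A)
      {p \<in> topspace (prod_topology W A). F (fst p) (snd p) \<in> U}" (is "openin _ ?P")
  proof (subst openin_subopen, intro ballI)
    fix p assume "p \<in> ?P"
    then obtain w a where p: "p = (w, a)" and w: "w \<in> topspace W" and a: "a \<in> topspace A"
      and Fwa: "F w a \<in> U" by (cases p) auto
    have "continuous_map A Z (F w)" using FW[OF w] by (simp add: maps_def)
    then have "openin A {x \<in> topspace A. F w x \<in> U}" (is "openin A ?S")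
      using U by (rule openin_continuous_map_preimage)
    moreover have "a \<in> ?S" using a Fwa by simp
    moreover have "neighbourhood_base_of (compactin A) A"
      using A by (simp add: locally_compact_space_neighbourhood_base)
    ultimately have "\<exists>V K. openin A V \<and> compactin A K \<and> a \<in> V \<and> V \<subseteq> K \<and> K \<subseteq> ?S"
      unfolding neighbourhood_base_of by (elim allE[of _ ?S] allE[of _ a] impE conjI)
    then obtain V K where V: "openin A V" and K: "compactin A K"
      and "a \<in> V" "V \<subseteq> K" "K \<subseteq> ?S" by (elim exE conjE)
    let ?B = "{g \<in> maps A Z. g ` K \<subseteq> U}"
    let ?N = "{x \<in> topspace W. F x \<in> ?B}"
    have "openin W ?N"
      using F openin_map_space_basic[OF K U] by (rule openin_continuous_map_preimage)
    then have "openin (prod_topology W A) (?N \<times> V)" using V by (simp add: openin_prod_Times_iff)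
    moreover have "p \<in> ?N \<times> V"
      using p w FW[OF w] \<open>a \<in> V\<close> \<open>K \<subseteq> ?S\<close> by auto
    moreover have "?N \<times> V \<subseteq> ?P"
    proof
      fix q assume "q \<in> ?N \<times> V"
      then obtain x b where "q = (x, b)" "x \<in> topspace W" "F x ` K \<subseteq> U" "b \<in> V" by auto
      moreover have "b \<in> K" "b \<in> topspace A"
        using \<open>b \<in> V\<close> \<open>V \<subseteq> K\<close> openin_subset[OF V] by auto
      ultimately show "q \<in> ?P" by auto
    qed
    ultimately show "\<exists>T. openin (prod_topology W A) T \<and> p \<in> T \<and> T \<subseteq> ?P" by blast
  qed
qed

lemma continuous_map_evaluation:
  assumes "locally_compact_space A" "Hausdorff_space A"
    and "continuous_map W (map_space A Z) F" "continuous_map W A p"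
  shows "continuous_map W Z (\<lambda>w. F w (p w))"
proof -
  have "continuous_map W (prod_topology W A) (\<lambda>w. (w, p w))"
    using assms(4) by (simp add: continuous_map_pairwise o_def)
  from continuous_map_compose[OF this continuous_map_uncurry[OF assms(1-3)]]
  show ?thesis by (simp add: o_def)
qed

lemma continuous_map_precompose:
  assumes g: "continuous_map A B g"
  shows "continuous_map (map_space B Z) (map_space A Z) (\<lambda>h. restrict (h \<circ> g) (topspace A))"
proof -
  have in_maps: "restrict (h \<circ> g) (topspace A) \<in> maps A Z" if "h \<in> maps B Z" for h
    using that g by (intro restrict_in_maps continuous_map_compose) (auto simp: maps_def)
  show ?thesis
    unfolding map_space_def[of A]
  proof (rule continuous_on_generated_topo)
    fix S assume "S \<in> {{g \<in> maps A Z. g ` K \<subseteq> U} |K U. compactin A K \<and> openin Z U}"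
    then obtain K U where K: "compactin A K" and U: "openin Z U"
      and S: "S = {g \<in> maps A Z. g ` K \<subseteq> U}" by blast
    have "(\<lambda>h. restrict (h \<circ> g) (topspace A)) -` S \<inter> topspace (map_space B Z)
        = {h \<in> maps B Z. h ` (g ` K) \<subseteq> U}"
      using in_maps compactin_subset_topspace[OF K] by (auto simp: S image_subset_iff subset_iff)
    then show "openin (map_space B Z)
        ((\<lambda>h. restrict (h \<circ> g) (topspace A)) -` S \<inter> topspace (map_space B Z))"
      using openin_map_space_basic[OF image_compactin[OF K g] U] by simp
  next
    show "(\<lambda>h. restrict (h \<circ> g) (topspace A)) ` topspace (map_space B Z)
        \<subseteq> \<Union> {{g \<in> maps A Z. g ` K \<subseteq> U} |K U. compactin A K \<and> openin Z U}"
      unfolding topspace_map_space Union_subbasis_map_space using in_maps by (rule image_subsetI)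
  qed
qed

lemma continuous_map_eval_at:
  assumes a: "a \<in> topspace A"
  shows "continuous_map (map_space A Z) Z (\<lambda>g. g a)"
  unfolding continuous_map
proof (intro conjI allI impI)
  show "(\<lambda>g. g a) ` topspace (map_space A Z) \<subseteq> topspace Z"
    using a by (auto intro: maps_apply)
  fix U assume "openin Z U"
  then have "openin (map_space A Z) {g \<in> maps A Z. g ` {a} \<subseteq> U}"
    using a by (intro openin_map_space_basic) auto
  then show "openin (map_space A Z) {g \<in> topspace (map_space A Z). g a \<in> U}" by simp
qed

lemma continuous_map_postcompose:
  assumes A: "locally_compact_space A" "Hausdorff_space A" and w: "continuous_map X Z w"
  shows "continuous_map (map_space A X) (map_space A Z) (\<lambda>h. restrict (w \<circ> h) (topspace A))"
proof -
  have "continuous_map (prod_topology (map_space A X) A) X (\<lambda>p. (fst p) (snd p))"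
    by (rule continuous_map_evaluation[OF A continuous_map_fst continuous_map_snd])
  from continuous_map_curry[OF continuous_map_compose[OF this w]]
  show ?thesis by (simp add: o_def)
qed

section \<open>Cubes and spheroids\<close>

lemma topspace_cube: "topspace (cube n) = (\<Pi>\<^sub>E i\<in>{..<n}. {0..1})"
  by (simp add: cube_def)

lemma compact_Hausdorff_cube: "compact_space (cube n)" "Hausdorff_space (cube n)"
  "locally_compact_space (cube n)"
proof -
  show c: "compact_space (cube n)" and "Hausdorff_space (cube n)"
    by (auto simp: cube_def compact_space_product_topology Hausdorff_space_product_topology
        Hausdorff_space_subtopology compact_space_subtopology)
  then show "locally_compact_space (cube n)"
    by (simp add: compact_imp_locally_compact_space)
qed

lemma circle_props: "compact_space circle" "Hausdorff_space circle"
  "locally_compact_space circle"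
proof -
  show c: "compact_space circle" and "Hausdorff_space circle"
    by (auto simp: Hausdorff_space_subtopology compact_space_subtopology)
  then show "locally_compact_space circle"
    by (simp add: compact_imp_locally_compact_space)
qed

lemma continuous_map_into_cube:
  "continuous_map W (cube n) f \<longleftrightarrow>
     f \<in> topspace W \<rightarrow> extensional {..<n} \<and> (\<forall>i<n. continuous_map W unit_interval (\<lambda>w. f w i))"
  by (auto simp: cube_def continuous_map_componentwise)

lemma continuous_map_coord:
  "continuous_map W (cube n) f \<Longrightarrow> i < n \<Longrightarrow> continuous_map W unit_interval (\<lambda>w. f w i)"
  by (simp add: continuous_map_into_cube)

lemma continuous_map_update:
  assumes "continuous_map W (cube n) f" "continuous_map W unit_interval u" "i < n"
  shows "continuous_map W (cube n) (\<lambda>w. (f w)(i := u w))"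
  using assms by (auto simp: continuous_map_into_cube extensional_def Pi_iff)

lemma continuous_map_cube_coord: "i < n \<Longrightarrow> continuous_map (cube n) unit_interval (\<lambda>s. s i)"
  by (rule continuous_map_coord[OF continuous_map_id[unfolded id_def]])

lemma continuous_map_cube_update:
  "continuous_map (cube n) unit_interval u \<Longrightarrow> i < n \<Longrightarrow>
     continuous_map (cube n) (cube n) (\<lambda>s. s(i := u s))"
  by (rule continuous_map_update[OF continuous_map_id[unfolded id_def]])

lemma cube_update: "s \<in> topspace (cube n) \<Longrightarrow> i < n \<Longrightarrow> x \<in> {0..1} \<Longrightarrow> s(i := x) \<in> topspace (cube n)"
  by (auto simp: topspace_cube PiE_iff extensional_def)

lemma cube_coord: "s \<in> topspace (cube n) \<Longrightarrow> i < n \<Longrightarrow> s i \<in> {0..1}"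
  by (auto simp: topspace_cube PiE_iff)

lemma cube_boundary_subset: "cube_boundary n \<subseteq> topspace (cube n)"
  by (auto simp: cube_boundary_def)

lemma cube_boundary_update:
  assumes "s \<in> cube_boundary n" "i < n" "x \<in> {0..1}" "s i = 0 \<or> s i = 1 \<Longrightarrow> x = 0 \<or> x = 1"
  shows "s(i := x) \<in> cube_boundary n"
proof -
  from assms(1) obtain j where j: "j < n" "s j = 0 \<or> s j = 1" and s: "s \<in> topspace (cube n)"
    unfolding cube_boundary_def by blast
  have "\<exists>k<n. (s(i := x)) k = 0 \<or> (s(i := x)) k = 1"
  proof (cases "j = i")
    case True
    then have "x = 0 \<or> x = 1" using j assms(4) by simp
    then show ?thesis using assms(2) by (intro exI[of _ i]) simp
  next
    case False
    then show ?thesis using j by (intro exI[of _ j]) simp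
  qed
  then show ?thesis
    using cube_update[OF s assms(2,3)] unfolding cube_boundary_def by blast
qed

lemma cube_boundary_updateI:
  assumes "s \<in> topspace (cube n)" "i < n" "x = 0 \<or> x = 1"
  shows "s(i := x) \<in> cube_boundary n"
  using assms cube_update[of s n i x] unfolding cube_boundary_def by auto

lemma cube_boundaryI:
  "s \<in> topspace (cube n) \<Longrightarrow> i < n \<Longrightarrow> s i = 0 \<or> s i = 1 \<Longrightarrow> s \<in> cube_boundary n"
  unfolding cube_boundary_def by auto

lemma continuous_map_unit_real:
  "continuous_map W unit_interval u \<longleftrightarrow>
     continuous_map W euclideanreal u \<and> (\<forall>w\<in>topspace W. u w \<in> {0..1})"
  by (auto simp: continuous_map_in_subtopology)

lemma continuous_map_unit_compose:
  fixes \<phi> :: "real \<Rightarrow> real"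
  assumes "continuous_on {0..1} \<phi>" "\<And>x. x \<in> {0..1} \<Longrightarrow> \<phi> x \<in> {0..1}"
    and u: "continuous_map W unit_interval u"
  shows "continuous_map W unit_interval (\<lambda>w. \<phi> (u w))"
proof -
  have "continuous_map unit_interval unit_interval \<phi>"
    using assms(1,2) by (auto simp: continuous_map_in_subtopology)
  from continuous_map_compose[OF u this] show ?thesis by (simp add: o_def)
qed

lemma convex_combination_unit:
  fixes t a b :: real
  assumes "t \<in> {0..1}" "a \<in> {0..1}" "b \<in> {0..1}"
  shows "(1 - t) * a + t * b \<in> {0..1}"
proof -
  have "(1 - t) * a \<le> (1 - t) * 1" "t * b \<le> t * 1"
    using assms by (auto intro!: mult_left_mono simp del: mult_1_right)
  moreover have "0 \<le> (1 - t) * a" "0 \<le> t * b" using assms by auto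
  ultimately show ?thesis by simp
qed

lemma continuous_map_unit_lerp:
  assumes "continuous_map W unit_interval t" "continuous_map W unit_interval u"
    and "continuous_map W unit_interval v"
  shows "continuous_map W unit_interval (\<lambda>w. (1 - t w) * u w + t w * v w)"
  using assms unfolding continuous_map_unit_real
  by (auto intro!: continuous_intros convex_combination_unit simp del: atLeastAtMost_iff)

lemma continuous_map_constI: "c \<in> topspace Y \<Longrightarrow> continuous_map X Y (\<lambda>x. c)"
  by simp


abbreviation sph_homotopic ::
    "nat \<Rightarrow> 'a topology \<Rightarrow> 'a \<Rightarrow> ((nat \<Rightarrow> real) \<Rightarrow> 'a) \<Rightarrow> ((nat \<Rightarrow> real) \<Rightarrow> 'a) \<Rightarrow> bool" where
  "sph_homotopic n X x0 \<equiv> homotopic_with (\<lambda>h. \<forall>s \<in> cube_boundary n. h s = x0) (cube n) X"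

lemma sph_homotopic_iff:
  "sph_homotopic n X x0 f g \<longleftrightarrow>
     (\<exists>h. continuous_map (prod_topology unit_interval (cube n)) X h \<and>
          (\<forall>s \<in> topspace (cube n). h (0, s) = f s) \<and>
          (\<forall>s \<in> topspace (cube n). h (1, s) = g s) \<and>
          (\<forall>t \<in> {0..1}. \<forall>s \<in> cube_boundary n. h (t, s) = x0))"
proof (rule homotopic_with)
  fix h k :: "(nat \<Rightarrow> real) \<Rightarrow> 'a"
  assume "\<And>x. x \<in> topspace (cube n) \<Longrightarrow> h x = k x"
  then show "(\<forall>s\<in>cube_boundary n. h s = x0) = (\<forall>s\<in>cube_boundary n. k s = x0)"
    using subsetD[OF cube_boundary_subset[of n]] by auto
qed

lemma sph_homotopicI:
  assumes "continuous_map (prod_topology unit_interval (cube n)) X h"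
    and "\<And>s. s \<in> topspace (cube n) \<Longrightarrow> h (0, s) = f s"
    and "\<And>s. s \<in> topspace (cube n) \<Longrightarrow> h (1, s) = g s"
    and "\<And>t s. t \<in> {0..1} \<Longrightarrow> s \<in> cube_boundary n \<Longrightarrow> h (t, s) = x0"
  shows "sph_homotopic n X x0 f g"
  unfolding sph_homotopic_iff using assms by blast

lemma sph_homotopicE:
  assumes "sph_homotopic n X x0 f g"
  obtains h where "continuous_map (prod_topology unit_interval (cube n)) X h"
    and "\<And>s. s \<in> topspace (cube n) \<Longrightarrow> h (0, s) = f s"
    and "\<And>s. s \<in> topspace (cube n) \<Longrightarrow> h (1, s) = g s"
    and "\<And>t s. t \<in> {0..1} \<Longrightarrow> s \<in> cube_boundary n \<Longrightarrow> h (t, s) = x0"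
  using assms unfolding sph_homotopic_iff by blast

lemma spheroid_boundary: "f \<in> spheroids n X x0 \<Longrightarrow> s \<in> cube_boundary n \<Longrightarrow> f s = x0"
  by (simp add: spheroids_def)

lemma spheroid_in_maps: "f \<in> spheroids n X x0 \<Longrightarrow> f \<in> maps (cube n) X"
  by (simp add: spheroids_def)

lemma spheroid_continuous: "f \<in> spheroids n X x0 \<Longrightarrow> continuous_map (cube n) X f"
  by (simp add: spheroids_def maps_def)

lemma spheroid_apply: "f \<in> spheroids n X x0 \<Longrightarrow> s \<in> topspace (cube n) \<Longrightarrow> f s \<in> topspace X"
  by (metis spheroid_in_maps maps_apply)

lemma spheroid_face:
  "f \<in> spheroids n X x0 \<Longrightarrow> s \<in> topspace (cube n) \<Longrightarrow> i < n \<Longrightarrow> f (s(i := 0)) = x0"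
  "f \<in> spheroids n X x0 \<Longrightarrow> s \<in> topspace (cube n) \<Longrightarrow> i < n \<Longrightarrow> f (s(i := 1)) = x0"
  by (erule spheroid_boundary, rule cube_boundary_updateI, auto)+

lemma restrict_spheroid:
  assumes "continuous_map (cube n) X f" "\<And>s. s \<in> cube_boundary n \<Longrightarrow> f s = x0"
  shows "restrict f (topspace (cube n)) \<in> spheroids n X x0"
  unfolding spheroids_def using restrict_in_maps[OF assms(1)] assms(2) cube_boundary_subset by auto

lemma const_spheroid: "x0 \<in> topspace X \<Longrightarrow> const_map (cube n) x0 \<in> spheroids n X x0"
  unfolding const_map_def by (intro restrict_spheroid) auto

lemma sph_homotopic_refl: "f \<in> spheroids n X x0 \<Longrightarrow> sph_homotopic n X x0 f f"
  by (simp add: spheroids_def maps_def)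

lemma htpy_class_self: "f \<in> spheroids n X x0 \<Longrightarrow> f \<in> htpy_class n X x0 f"
  unfolding htpy_class_def by (intro CollectI conjI sph_homotopic_refl)

lemma htpy_class_eq_iff:
  assumes "f \<in> spheroids n X x0" "g \<in> spheroids n X x0"
  shows "htpy_class n X x0 f = htpy_class n X x0 g \<longleftrightarrow> sph_homotopic n X x0 f g"
proof
  assume "htpy_class n X x0 f = htpy_class n X x0 g"
  with htpy_class_self[OF assms(2)] have "g \<in> htpy_class n X x0 f" by simp
  then show "sph_homotopic n X x0 f g" by (simp add: htpy_class_def)
next
  assume "sph_homotopic n X x0 f g"
  then show "htpy_class n X x0 f = htpy_class n X x0 g"
    unfolding htpy_class_def by (auto intro: homotopic_with_trans homotopic_with_symD)
qed

text \<open>An operation on spheroids that respects homotopy takes one and the same class at all members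
  of a class, so that the unions in the definitions of the group operations collapse.\<close>

lemma Union_htpy_class:
  assumes f: "f \<in> spheroids n X x0"
    and \<Psi>: "\<And>g. g \<in> spheroids n X x0 \<Longrightarrow> \<Psi> g \<in> spheroids m Z z0"
    and resp: "\<And>g. g \<in> spheroids n X x0 \<Longrightarrow> sph_homotopic n X x0 f g \<Longrightarrow>
                 sph_homotopic m Z z0 (\<Psi> f) (\<Psi> g)"
  shows "(\<Union>g\<in>htpy_class n X x0 f. htpy_class m Z z0 (\<Psi> g)) = htpy_class m Z z0 (\<Psi> f)"
proof -
  have "htpy_class m Z z0 (\<Psi> g) = htpy_class m Z z0 (\<Psi> f)" if "g \<in> htpy_class n X x0 f" for g
    using that f \<Psi> resp
    by (subst htpy_class_eq_iff) (auto simp: htpy_class_def intro: homotopic_with_symD)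
  with htpy_class_self[OF f] show ?thesis by blast
qed

section \<open>Homotopy groups\<close>

text \<open>The parameter space \<open>A\<close> makes the lemma apply to spheroids and to homotopies between them alike.\<close>

lemma continuous_map_concat:
  assumes n: "n \<ge> 1"
    and f: "continuous_map (prod_topology A (cube n)) X f"
    and g: "continuous_map (prod_topology A (cube n)) X g"
    and fg: "\<And>a s. a \<in> topspace A \<Longrightarrow> s \<in> topspace (cube n) \<Longrightarrow> f (a, s(0 := 1)) = g (a, s(0 := 0))"
  shows "continuous_map (prod_topology A (cube n)) X
           (\<lambda>p. if snd p 0 \<le> 1/2 then f (fst p, (snd p)(0 := 2 * snd p 0))
                else g (fst p, (snd p)(0 := 2 * snd p 0 - 1)))"
proof -
  let ?P = "prod_topology A (cube n)"
  \<comment> \<open>The two halves, clamped so that they are continuous on the whole cube.\<close>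
  let ?u = "\<lambda>p. min 1 (2 * snd p 0)" and ?v = "\<lambda>p. max 0 (2 * snd p 0 - 1)"
  have c0: "continuous_map ?P unit_interval (\<lambda>p. snd p 0)"
    using n by (intro continuous_map_coord[OF continuous_map_snd]) auto
  have u: "continuous_map ?P unit_interval ?u"
    by (rule continuous_map_unit_compose[where \<phi> = "\<lambda>x. min 1 (2 * x)", OF _ _ c0])
       (auto intro!: continuous_intros)
  have v: "continuous_map ?P unit_interval ?v"
    by (rule continuous_map_unit_compose[where \<phi> = "\<lambda>x. max 0 (2 * x - 1)", OF _ _ c0])
       (auto intro!: continuous_intros)
  have upd: "continuous_map ?P ?P (\<lambda>p. (fst p, (snd p)(0 := w p)))"
    if "continuous_map ?P unit_interval w" for w
    using n that by (simp add: continuous_map_pairwise o_def continuous_map_fst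
        continuous_map_update[OF continuous_map_snd])
  have fu: "continuous_map ?P X (\<lambda>p. f (fst p, (snd p)(0 := ?u p)))"
    using continuous_map_compose[OF upd[OF u] f] by (simp add: o_def)
  have gv: "continuous_map ?P X (\<lambda>p. g (fst p, (snd p)(0 := ?v p)))"
    using continuous_map_compose[OF upd[OF v] g] by (simp add: o_def)
  have "continuous_map ?P X (\<lambda>p. if snd p 0 \<le> 1/2 then f (fst p, (snd p)(0 := ?u p))
      else g (fst p, (snd p)(0 := ?v p)))"
  proof (rule continuous_map_cases_le)
    show "continuous_map ?P euclideanreal (\<lambda>p. snd p 0)"
      using c0 by (simp add: continuous_map_in_subtopology)
  qed (use fg in \<open>auto intro: continuous_map_from_subtopology[OF fu]
         continuous_map_from_subtopology[OF gv]\<close>)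
  moreover have "min 1 (2 * x) = 2 * x" if "x \<le> 1/2" for x :: real using that by simp
  moreover have "max 0 (2 * x - 1) = 2 * x - 1" if "\<not> x \<le> 1/2" for x :: real using that by simp
  ultimately show ?thesis
    by (elim continuous_map_eq) (simp del: le_divide_eq_numeral1)
qed

lemma continuous_map_of_cube_param:
  "continuous_map (cube n) X f \<Longrightarrow> continuous_map (prod_topology A (cube n)) X (\<lambda>p. f (snd p))"
  using continuous_map_compose[OF continuous_map_snd] by (auto simp: o_def)

lemma concat_spheroid:
  assumes n: "n \<ge> 1" and f: "f \<in> spheroids n X x0" and g: "g \<in> spheroids n X x0"
  shows "spheroid_concat n f g \<in> spheroids n X x0"
proof -
  let ?c = "\<lambda>s. if s 0 \<le> 1/2 then f (s(0 := 2 * s 0)) else g (s(0 := 2 * s 0 - 1))"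
  have c: "continuous_map (prod_topology unit_interval (cube n)) X
      (\<lambda>p. if snd p 0 \<le> 1/2 then f (snd (fst p, (snd p)(0 := 2 * snd p 0)))
           else g (snd (fst p, (snd p)(0 := 2 * snd p 0 - 1))))"
    by (rule continuous_map_concat[OF n continuous_map_of_cube_param[OF spheroid_continuous[OF f]]
          continuous_map_of_cube_param[OF spheroid_continuous[OF g]]])
       (use n in \<open>simp add: spheroid_face[OF f] spheroid_face[OF g]\<close>)
  have "continuous_map (cube n) X ?c"
    using continuous_map_slice[OF c, of 0] by (simp cong: if_cong)
  moreover have "?c s = x0" if s: "s \<in> cube_boundary n" for s
  proof -
    have s0: "s 0 \<in> {0..1}" using s n cube_boundary_subset cube_coord[of s n 0] by auto
    show ?thesis
      using n s0 by (auto intro!: spheroid_boundary[OF f] spheroid_boundary[OF g]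
          cube_boundary_update[OF s])
  qed
  ultimately show ?thesis
    unfolding spheroid_concat_def by (rule restrict_spheroid)
qed

lemma concat_homotopic:
  assumes n: "n \<ge> 1" and f: "sph_homotopic n X x0 f f'" and g: "sph_homotopic n X x0 g g'"
  shows "sph_homotopic n X x0 (spheroid_concat n f g) (spheroid_concat n f' g')"
proof -
  obtain h where h: "continuous_map (prod_topology unit_interval (cube n)) X h"
    and h0: "\<And>s. s \<in> topspace (cube n) \<Longrightarrow> h (0, s) = f s"
    and h1: "\<And>s. s \<in> topspace (cube n) \<Longrightarrow> h (1, s) = f' s"
    and hb: "\<And>t s. t \<in> {0..1} \<Longrightarrow> s \<in> cube_boundary n \<Longrightarrow> h (t, s) = x0"
    using f by (rule sph_homotopicE) blast
  obtain k where k: "continuous_map (prod_topology unit_interval (cube n)) X k"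
    and k0: "\<And>s. s \<in> topspace (cube n) \<Longrightarrow> k (0, s) = g s"
    and k1: "\<And>s. s \<in> topspace (cube n) \<Longrightarrow> k (1, s) = g' s"
    and kb: "\<And>t s. t \<in> {0..1} \<Longrightarrow> s \<in> cube_boundary n \<Longrightarrow> k (t, s) = x0"
    using g by (rule sph_homotopicE) blast
  let ?c = "\<lambda>p. if snd p 0 \<le> 1/2 then h (fst p, (snd p)(0 := 2 * snd p 0))
                else k (fst p, (snd p)(0 := 2 * snd p 0 - 1))"
  have upd: "s(0 := 2 * s 0) \<in> topspace (cube n)" if "s \<in> topspace (cube n)" "s 0 \<le> 1/2" for s
    using that n cube_coord[of s n 0] by (intro cube_update) auto
  have upd': "s(0 := 2 * s 0 - 1) \<in> topspace (cube n)"
    if "s \<in> topspace (cube n)" "\<not> s 0 \<le> 1/2" for s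
    using that n cube_coord[of s n 0] by (intro cube_update) auto
  show ?thesis
  proof (rule sph_homotopicI)
    show "continuous_map (prod_topology unit_interval (cube n)) X ?c"
      using n h k by (rule continuous_map_concat)
        (use n in \<open>auto simp: hb[OF _ cube_boundary_updateI] kb[OF _ cube_boundary_updateI]\<close>)
    show "?c (0, s) = spheroid_concat n f g s" if "s \<in> topspace (cube n)" for s
      using that h0 k0 upd upd' by (simp add: spheroid_concat_def)
    show "?c (1, s) = spheroid_concat n f' g' s" if "s \<in> topspace (cube n)" for s
      using that h1 k1 upd upd' by (simp add: spheroid_concat_def)
    show "?c (t, s) = x0" if t: "t \<in> {0..1}" and s: "s \<in> cube_boundary n" for t s
    proof -
      have s0: "s 0 \<in> {0..1}" using s n cube_boundary_subset cube_coord[of s n 0] by auto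
      show ?thesis
        using n s0 t by (auto intro!: hb kb cube_boundary_update[OF s])
    qed
  qed
qed

text \<open>Two reparametrizations of the first coordinate that agree at its ends are joined by a straight
  line. All group laws up to homotopy, including inverses, are instances: both sides are one spheroid
  reparametrized in two ways.\<close>

lemma homotopic_reparam:
  fixes p q :: "real \<Rightarrow> real"
  assumes n: "n \<ge> 1" and f: "f \<in> spheroids n X x0"
    and p: "continuous_on {0..1} p" "\<And>x. x \<in> {0..1} \<Longrightarrow> p x \<in> {0..1}"
    and q: "continuous_on {0..1} q" "\<And>x. x \<in> {0..1} \<Longrightarrow> q x \<in> {0..1}"
    and ends: "p 0 = q 0" "p 0 = 0 \<or> p 0 = 1" "p 1 = q 1" "p 1 = 0 \<or> p 1 = 1"
    and f': "\<And>s. s \<in> topspace (cube n) \<Longrightarrow> f' s = f (s(0 := p (s 0)))"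
    and f'': "\<And>s. s \<in> topspace (cube n) \<Longrightarrow> f'' s = f (s(0 := q (s 0)))"
  shows "sph_homotopic n X x0 f' f''"
proof (rule sph_homotopicI)
  let ?P = "prod_topology unit_interval (cube n)"
  let ?u = "\<lambda>w. (1 - fst w) * p (snd w 0) + fst w * q (snd w 0)"
  let ?h = "\<lambda>w. f ((snd w)(0 := ?u w))"
  have c0: "continuous_map ?P unit_interval (\<lambda>w. snd w 0)"
    using n by (intro continuous_map_coord[OF continuous_map_snd]) auto
  have "continuous_map ?P unit_interval ?u"
    by (rule continuous_map_unit_lerp[OF continuous_map_fst
          continuous_map_unit_compose[OF p c0] continuous_map_unit_compose[OF q c0]])
  then have "continuous_map ?P (cube n) (\<lambda>w. (snd w)(0 := ?u w))"
    using n by (intro continuous_map_update[OF continuous_map_snd]) auto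
  from continuous_map_compose[OF this spheroid_continuous[OF f]]
  show "continuous_map ?P X ?h" by (simp add: o_def)
  show "?h (0, s) = f' s" "?h (1, s) = f'' s" if "s \<in> topspace (cube n)" for s
    using that f' f'' by auto
  show "?h (t, s) = x0" if t: "t \<in> {0..1}" and s: "s \<in> cube_boundary n" for t s
  proof -
    have s0: "s 0 \<in> {0..1}" using s n cube_boundary_subset cube_coord[of s n 0] by auto
    have "?u (t, s) = 0 \<or> ?u (t, s) = 1" if "s 0 = 0 \<or> s 0 = 1"
      using that ends by (auto simp: algebra_simps)
    moreover have "?u (t, s) \<in> {0..1}"
      using convex_combination_unit[OF t p(2)[OF s0] q(2)[OF s0]] by simp
    ultimately show ?thesis
      using n by (auto intro!: spheroid_boundary[OF f] cube_boundary_update[OF s])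
  qed
qed

lemma homotopy_group_mult:
  assumes n: "n \<ge> 1" and f: "f \<in> spheroids n X x0" and g: "g \<in> spheroids n X x0"
  shows "htpy_class n X x0 f \<otimes>\<^bsub>homotopy_group n X x0\<^esub> htpy_class n X x0 g
           = htpy_class n X x0 (spheroid_concat n f g)"
proof -
  have "(\<Union>b\<in>htpy_class n X x0 g. htpy_class n X x0 (spheroid_concat n a b))
      = htpy_class n X x0 (spheroid_concat n a g)" if "a \<in> spheroids n X x0" for a
    using n g that by (intro Union_htpy_class concat_spheroid concat_homotopic sph_homotopic_refl)
  then have "htpy_class n X x0 f \<otimes>\<^bsub>homotopy_group n X x0\<^esub> htpy_class n X x0 g
      = (\<Union>a\<in>htpy_class n X x0 f. htpy_class n X x0 (spheroid_concat n a g))"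
    unfolding homotopy_group_def by (simp add: htpy_class_def[of n X x0 f])
  also have "\<dots> = htpy_class n X x0 (spheroid_concat n f g)"
    using n f g by (intro Union_htpy_class concat_spheroid concat_homotopic sph_homotopic_refl)
  finally show ?thesis .
qed

lemma homotopy_group_one: "\<one>\<^bsub>homotopy_group n X x0\<^esub> = htpy_class n X x0 (const_map (cube n) x0)"
  by (simp add: homotopy_group_def)

lemma homotopy_group_carrier:
  "carrier (homotopy_group n X x0) = htpy_class n X x0 ` spheroids n X x0"
  by (simp add: homotopy_group_def)

definition reverse_spheroid :: "nat \<Rightarrow> ((nat \<Rightarrow> real) \<Rightarrow> 'a) \<Rightarrow> (nat \<Rightarrow> real) \<Rightarrow> 'a" where
  "reverse_spheroid n f = (\<lambda>s\<in>topspace (cube n). f (s(0 := 1 - s 0)))"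

lemma reverse_spheroid:
  assumes n: "n \<ge> 1" and f: "f \<in> spheroids n X x0"
  shows "reverse_spheroid n f \<in> spheroids n X x0"
  unfolding reverse_spheroid_def
proof (rule restrict_spheroid)
  have c0: "continuous_map (cube n) unit_interval (\<lambda>s. s 0)"
    using n by (intro continuous_map_cube_coord) auto
  have "continuous_map (cube n) unit_interval (\<lambda>s. 1 - s 0)"
    by (rule continuous_map_unit_compose[OF _ _ c0]) (auto intro!: continuous_intros)
  then have "continuous_map (cube n) (cube n) (\<lambda>s. s(0 := 1 - s 0))"
    using n by (intro continuous_map_cube_update) auto
  from continuous_map_compose[OF this spheroid_continuous[OF f]]
  show "continuous_map (cube n) X (\<lambda>s. f (s(0 := 1 - s 0)))" by (simp add: o_def)
  show "f (s(0 := 1 - s 0)) = x0" if s: "s \<in> cube_boundary n" for s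
  proof -
    have "s 0 \<in> {0..1}" using s n cube_boundary_subset cube_coord[of s n 0] by auto
    then show ?thesis
      using n by (auto intro!: spheroid_boundary[OF f] cube_boundary_update[OF s])
  qed
qed

lemma concat_const_left:
  assumes n: "n \<ge> 1" and f: "f \<in> spheroids n X x0"
  shows "sph_homotopic n X x0 (spheroid_concat n (const_map (cube n) x0) f) f"
proof (rule homotopic_reparam[OF n f, where p = "\<lambda>x. max 0 (2 * x - 1)" and q = "\<lambda>x. x"])
  fix s assume s: "s \<in> topspace (cube n)"
  have s0: "s 0 \<in> {0..1}" using s n cube_coord[of s n 0] by auto
  have "const_map (cube n) x0 (s(0 := 2 * s 0)) = x0" if "s 0 \<le> 1/2"
    unfolding const_map_def using s n that s0 by (auto intro!: cube_update)
  moreover have "f (s(0 := 0)) = x0"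
    using s n by (simp add: spheroid_face[OF f])
  moreover have "max 0 (2 * s 0 - 1) = (if s 0 \<le> 1/2 then 0 else 2 * s 0 - 1)" by simp
  ultimately show "spheroid_concat n (const_map (cube n) x0) f s = f (s(0 := max 0 (2 * s 0 - 1)))"
    using s by (simp add: spheroid_concat_def del: le_divide_eq_numeral1)
qed (auto intro!: continuous_intros)

text \<open>Running backwards and then forwards through \<open>f\<close> is \<open>f\<close> reparametrized by \<open>x \<mapsto> \<bar>2 x - 1\<bar>\<close>, which starts
  and ends at 1 and can be pulled to the constant 1, where \<open>f\<close> takes the base point.\<close>

lemma concat_reverse_left:
  assumes n: "n \<ge> 1" and f: "f \<in> spheroids n X x0"
  shows "sph_homotopic n X x0 (spheroid_concat n (reverse_spheroid n f) f) (const_map (cube n) x0)"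
proof (rule homotopic_reparam[OF n f, where p = "\<lambda>x. \<bar>2 * x - 1\<bar>" and q = "\<lambda>x. 1"])
  fix s assume s: "s \<in> topspace (cube n)"
  have s0: "s 0 \<in> {0..1}" using s n cube_coord[of s n 0] by auto
  have "reverse_spheroid n f (s(0 := 2 * s 0)) = f (s(0 := 1 - 2 * s 0))" if "s 0 \<le> 1/2"
    using s n that s0 cube_update[of s n 0 "2 * s 0"] by (auto simp: reverse_spheroid_def)
  moreover have "\<bar>2 * s 0 - 1\<bar> = (if s 0 \<le> 1/2 then 1 - 2 * s 0 else 2 * s 0 - 1)" by simp
  ultimately show "spheroid_concat n (reverse_spheroid n f) f s = f (s(0 := \<bar>2 * s 0 - 1\<bar>))"
    using s by (simp add: spheroid_concat_def del: le_divide_eq_numeral1)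
  show "const_map (cube n) x0 s = f (s(0 := 1))"
    using s n by (simp add: const_map_def spheroid_face[OF f])
qed (auto intro!: continuous_intros)

lemma concat_assoc:
  assumes n: "n \<ge> 1" and f: "f \<in> spheroids n X x0" and g: "g \<in> spheroids n X x0"
    and h: "h \<in> spheroids n X x0"
  shows "sph_homotopic n X x0 (spheroid_concat n (spheroid_concat n f g) h)
           (spheroid_concat n f (spheroid_concat n g h))"
proof (rule homotopic_reparam[OF n concat_spheroid[OF n f concat_spheroid[OF n g h]],
      where p = "\<lambda>x. min (2 * x) (min (x + 1/4) ((x + 1) / 2))" and q = "\<lambda>x. x"])
  \<comment> \<open>The concave piecewise linear map that takes the break points 1/4, 1/2 to 1/2, 3/4.\<close>
  let ?p = "\<lambda>x. min (2 * x) (min (x + 1/4) ((x + 1) / (2::real)))"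
  fix s assume s: "s \<in> topspace (cube n)"
  have s0: "s 0 \<in> {0..1}" using s n cube_coord[of s n 0] by auto
  have top: "s(0 := x) \<in> topspace (cube n)" if "x \<in> {0..1}" for x
    using s n that by (intro cube_update) auto

  consider "s 0 \<le> 1/4" | "1/4 < s 0" "s 0 \<le> 1/2" | "1/2 < s 0" by linarith
  then show "spheroid_concat n (spheroid_concat n f g) h s
      = spheroid_concat n f (spheroid_concat n g h) (s(0 := ?p (s 0)))"
  proof cases
    case 1
    then have "?p (s 0) = 2 * s 0" by (auto simp: min_def)
    with 1 s s0 show ?thesis using top[of "2 * s 0"] by (simp add: spheroid_concat_def)
  next
    case 2
    then have "?p (s 0) = s 0 + 1/4" by (auto simp: min_def)
    with 2 s s0 show ?thesis
      using top[of "2 * s 0"] top[of "s 0 + 1/4"] top[of "2 * (s 0 + 1/4) - 1"]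
      by (simp add: spheroid_concat_def algebra_simps)
  next
    case 3
    then have "?p (s 0) = (s 0 + 1) / 2" by (auto simp: min_def)
    moreover define x where "x = (s 0 + 1) / 2"
    ultimately have x: "?p (s 0) = x" "2 * x - 1 = s 0" "\<not> x \<le> 1/2" "x \<in> {0..1}"
      using 3 s0 by (auto simp: field_simps)
    have "spheroid_concat n f (spheroid_concat n g h) (s(0 := x)) = spheroid_concat n g h s"
      using x(2,3) top[OF x(4)] by (simp add: spheroid_concat_def)
    with 3 s show ?thesis
      unfolding x(1) by (simp add: spheroid_concat_def)
  qed
qed (auto intro!: continuous_intros simp: min_le_iff_disj)

lemma homotopy_group_is_group:
  assumes n: "n \<ge> 1" and x0: "x0 \<in> topspace X"
  shows "group (homotopy_group n X x0)"
proof (rule groupI, goal_cases)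
  case (1 A B)
  then show ?case
    using n by (auto simp: homotopy_group_carrier homotopy_group_mult intro!: concat_spheroid)
next
  case 2
  then show ?case
    using x0 by (auto simp: homotopy_group_carrier homotopy_group_one intro!: const_spheroid)
next
  case (3 A B C)
  then show ?case
    unfolding homotopy_group_carrier
    using n by (elim imageE)
      (simp add: homotopy_group_mult concat_spheroid htpy_class_eq_iff concat_assoc)
next
  case (4 A)
  then show ?case
    unfolding homotopy_group_carrier
    using n x0 by (elim imageE) (simp add: homotopy_group_one homotopy_group_mult
        concat_spheroid const_spheroid htpy_class_eq_iff concat_const_left)
next
  case (5 A)
  then obtain f where f: "f \<in> spheroids n X x0" "A = htpy_class n X x0 f"
    by (auto simp: homotopy_group_carrier)
  with n x0 have "htpy_class n X x0 (reverse_spheroid n f) \<otimes>\<^bsub>homotopy_group n X x0\<^esub> A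
      = \<one>\<^bsub>homotopy_group n X x0\<^esub>"
    by (simp add: homotopy_group_one homotopy_group_mult reverse_spheroid concat_spheroid
        const_spheroid htpy_class_eq_iff concat_reverse_left)
  moreover have "htpy_class n X x0 (reverse_spheroid n f) \<in> carrier (homotopy_group n X x0)"
    using n f by (auto simp: homotopy_group_carrier reverse_spheroid)
  ultimately show ?case by blast
qed

section \<open>Homomorphisms between homotopy groups\<close>

text \<open>An operation on spheroids that respects homotopy and concatenation induces a homomorphism of
  homotopy groups, possibly of different degrees; the degree shift is needed for the passage from
  spheroids of a space to spheroids of its loop space.\<close>

definition class_op ::
    "nat \<Rightarrow> 'b topology \<Rightarrow> 'b \<Rightarrow> (((nat \<Rightarrow> real) \<Rightarrow> 'a) \<Rightarrow> (nat \<Rightarrow> real) \<Rightarrow> 'b)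
       \<Rightarrow> ((nat \<Rightarrow> real) \<Rightarrow> 'a) set \<Rightarrow> ((nat \<Rightarrow> real) \<Rightarrow> 'b) set" where
  "class_op m Z z0 \<Psi> A = (\<Union>f\<in>A. htpy_class m Z z0 (\<Psi> f))"

definition spheroid_op ::
    "nat \<Rightarrow> 'a topology \<Rightarrow> 'a \<Rightarrow> nat \<Rightarrow> 'b topology \<Rightarrow> 'b
       \<Rightarrow> (((nat \<Rightarrow> real) \<Rightarrow> 'a) \<Rightarrow> (nat \<Rightarrow> real) \<Rightarrow> 'b) \<Rightarrow> bool" where
  "spheroid_op n X x0 m Z z0 \<Psi> \<longleftrightarrow>
     (\<forall>f \<in> spheroids n X x0. \<Psi> f \<in> spheroids m Z z0 \<and>
        (\<forall>g \<in> spheroids n X x0.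
           (sph_homotopic n X x0 f g \<longrightarrow> sph_homotopic m Z z0 (\<Psi> f) (\<Psi> g)) \<and>
           \<Psi> (spheroid_concat n f g) = spheroid_concat m (\<Psi> f) (\<Psi> g)))"

lemma class_op_htpy_class:
  assumes "spheroid_op n X x0 m Z z0 \<Psi>" "f \<in> spheroids n X x0"
  shows "class_op m Z z0 \<Psi> (htpy_class n X x0 f) = htpy_class m Z z0 (\<Psi> f)"
  unfolding class_op_def
  using assms by (intro Union_htpy_class) (auto simp: spheroid_op_def)

lemma class_op_hom:
  assumes op: "spheroid_op n X x0 m Z z0 \<Psi>" and n: "n \<ge> 1" and m: "m \<ge> 1"
  shows "class_op m Z z0 \<Psi> \<in> hom (homotopy_group n X x0) (homotopy_group m Z z0)"
proof (rule homI)
  fix A assume "A \<in> carrier (homotopy_group n X x0)"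
  then show "class_op m Z z0 \<Psi> A \<in> carrier (homotopy_group m Z z0)"
    using op by (auto simp: homotopy_group_carrier class_op_htpy_class[OF op] spheroid_op_def)
next
  fix A B assume "A \<in> carrier (homotopy_group n X x0)" "B \<in> carrier (homotopy_group n X x0)"
  then obtain f g where f: "f \<in> spheroids n X x0" "A = htpy_class n X x0 f"
    and g: "g \<in> spheroids n X x0" "B = htpy_class n X x0 g"
    by (auto simp: homotopy_group_carrier)
  then show "class_op m Z z0 \<Psi> (A \<otimes>\<^bsub>homotopy_group n X x0\<^esub> B)
      = class_op m Z z0 \<Psi> A \<otimes>\<^bsub>homotopy_group m Z z0\<^esub> class_op m Z z0 \<Psi> B"
    using op n m by (simp add: homotopy_group_mult concat_spheroid class_op_htpy_class[OF op])
      (simp add: spheroid_op_def homotopy_group_mult)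
qed

abbreviation push :: "nat \<Rightarrow> ('a \<Rightarrow> 'b) \<Rightarrow> ((nat \<Rightarrow> real) \<Rightarrow> 'a) \<Rightarrow> (nat \<Rightarrow> real) \<Rightarrow> 'b" where
  "push n \<phi> f \<equiv> restrict (\<phi> \<circ> f) (topspace (cube n))"

lemma induced_hom_eq: "induced_hom n Z z0 \<phi> = class_op n Z z0 (push n \<phi>)"
  by (simp add: fun_eq_iff induced_hom_def class_op_def)

lemma push_concat:
  assumes n: "n \<ge> 1"
  shows "push n \<phi> (spheroid_concat n f g) = spheroid_concat n (push n \<phi> f) (push n \<phi> g)"
proof
  fix s
  show "push n \<phi> (spheroid_concat n f g) s = spheroid_concat n (push n \<phi> f) (push n \<phi> g) s"
  proof (cases "s \<in> topspace (cube n)")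
    case True
    then have "s 0 \<in> {0..1}" using n cube_coord by auto
    then have "s 0 \<le> 1/2 \<Longrightarrow> s(0 := 2 * s 0) \<in> topspace (cube n)"
      "\<not> s 0 \<le> 1/2 \<Longrightarrow> s(0 := 2 * s 0 - 1) \<in> topspace (cube n)"
      using True n by (auto intro!: cube_update)
    then show ?thesis using True by (auto simp: spheroid_concat_def)
  qed (simp add: spheroid_concat_def)
qed

lemma push_op:
  assumes n: "n \<ge> 1" and \<phi>: "continuous_map X Z \<phi>" "\<phi> x0 = z0"
  shows "spheroid_op n X x0 n Z z0 (push n \<phi>)"
  unfolding spheroid_op_def
proof (intro ballI conjI impI push_concat[OF n])
  fix f assume f: "f \<in> spheroids n X x0"
  show "push n \<phi> f \<in> spheroids n Z z0"
    using f \<phi> by (intro restrict_spheroid continuous_map_compose[OF spheroid_continuous])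
      (auto simp: spheroid_boundary)
  fix g assume "sph_homotopic n X x0 f g"
  then obtain h where h: "continuous_map (prod_topology unit_interval (cube n)) X h"
    and h0: "\<And>s. s \<in> topspace (cube n) \<Longrightarrow> h (0, s) = f s"
    and h1: "\<And>s. s \<in> topspace (cube n) \<Longrightarrow> h (1, s) = g s"
    and hb: "\<And>t s. t \<in> {0..1} \<Longrightarrow> s \<in> cube_boundary n \<Longrightarrow> h (t, s) = x0"
    by (rule sph_homotopicE) blast
  show "sph_homotopic n Z z0 (push n \<phi> f) (push n \<phi> g)"
    by (rule sph_homotopicI[OF continuous_map_compose[OF h \<phi>(1)]])
      (use h0 h1 hb \<phi>(2) in auto)
qed

lemma push_spheroid:
  assumes "n \<ge> 1" "continuous_map X Z \<phi>" "\<phi> x0 = z0" "f \<in> spheroids n X x0"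
  shows "push n \<phi> f \<in> spheroids n Z z0"
  using push_op[OF assms(1-3)] assms(4) by (simp add: spheroid_op_def)

lemma induced_hom_htpy_class:
  assumes "n \<ge> 1" "continuous_map X Z \<phi>" "\<phi> x0 = z0" "f \<in> spheroids n X x0"
  shows "induced_hom n Z z0 \<phi> (htpy_class n X x0 f) = htpy_class n Z z0 (push n \<phi> f)"
  unfolding induced_hom_eq using class_op_htpy_class[OF push_op[OF assms(1-3)] assms(4)] .

lemma induced_hom_in_hom:
  assumes "n \<ge> 1" "continuous_map X Z \<phi>" "\<phi> x0 = z0"
  shows "induced_hom n Z z0 \<phi> \<in> hom (homotopy_group n X x0) (homotopy_group n Z z0)"
  unfolding induced_hom_eq using class_op_hom[OF push_op[OF assms] assms(1,1)] .

section \<open>Spheroids stay in a path component\<close>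

lemma path_component_of_cube_image:
  assumes f: "continuous_map (cube n) X f" and "s \<in> topspace (cube n)" "s' \<in> topspace (cube n)"
  shows "path_component_of X (f s) (f s')"
proof -
  have "path_connected_space unit_interval"
    using path_connectedin_euclidean[of "{0..1::real}"]
    by (simp add: path_connectedin_def convex_imp_path_connected)
  then have "path_connected_space (cube n)"
    unfolding cube_def path_connected_space_product_topology by blast
  then have "path_connectedin X (f ` topspace (cube n))"
    using f by (simp add: path_connectedin_continuous_map_image path_connectedin_topspace)
  then show ?thesis using assms(2,3) unfolding path_component_of by blast
qed

lemma cube_boundary_nonempty:
  assumes "n \<ge> 1" shows "(\<lambda>i\<in>{..<n}. 0) \<in> cube_boundary n"
proof (rule cube_boundaryI[of _ _ 0])
  show "(\<lambda>i\<in>{..<n}. 0::real) \<in> topspace (cube n)" by (simp add: topspace_cube)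
qed (use assms in auto)

lemma path_component_of_spheroid:
  assumes n: "n \<ge> 1" and f: "continuous_map (cube n) X f"
    and b: "\<And>s. s \<in> cube_boundary n \<Longrightarrow> f s = x0" and s: "s \<in> topspace (cube n)"
  shows "path_component_of X x0 (f s)"
proof -
  have "f (\<lambda>i\<in>{..<n}. 0) = x0" using cube_boundary_nonempty[OF n] by (rule b)
  moreover have "path_component_of X (f (\<lambda>i\<in>{..<n}. 0)) (f s)"
    using subsetD[OF cube_boundary_subset cube_boundary_nonempty[OF n]] s
    by (rule path_component_of_cube_image[OF f])
  ultimately show ?thesis by simp
qed

text \<open>A spheroid of positive degree takes the base point somewhere on the cube, which is path connected;
  so do all stages of a homotopy of spheroids. Hence replacing a space by the path component of its
  base point changes no homotopy group of positive degree.\<close>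

lemma spheroids_path_component:
  assumes n: "n \<ge> 1"
  shows "spheroids n (path_component_space X x0) x0 = spheroids n X x0"
  unfolding spheroids_def maps_def path_component_space_def continuous_map_in_subtopology
  using path_component_of_spheroid[OF n, of X _ x0] by (auto simp: image_subset_iff)

lemma sph_homotopic_path_component:
  assumes n: "n \<ge> 1"
  shows "sph_homotopic n (path_component_space X x0) x0 f g \<longleftrightarrow> sph_homotopic n X x0 f g"
proof
  assume "sph_homotopic n (path_component_space X x0) x0 f g"
  then show "sph_homotopic n X x0 f g"
    unfolding sph_homotopic_iff path_component_space_def continuous_map_in_subtopology by blast
next
  assume "sph_homotopic n X x0 f g"
  then obtain h where h: "continuous_map (prod_topology unit_interval (cube n)) X h"
    and h0: "\<And>s. s \<in> topspace (cube n) \<Longrightarrow> h (0, s) = f s"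
    and h1: "\<And>s. s \<in> topspace (cube n) \<Longrightarrow> h (1, s) = g s"
    and hb: "\<And>t s. t \<in> {0..1} \<Longrightarrow> s \<in> cube_boundary n \<Longrightarrow> h (t, s) = x0"
    by (rule sph_homotopicE) blast
  have "path_component_of X x0 (h (t, s))" if "t \<in> {0..1}" "s \<in> topspace (cube n)" for t s
    using path_component_of_spheroid[OF n continuous_map_slice[OF h, of t] hb] that by simp
  then have "continuous_map (prod_topology unit_interval (cube n)) (path_component_space X x0) h"
    unfolding path_component_space_def using h
    by (intro continuous_map_into_subtopology) auto
  then show "sph_homotopic n (path_component_space X x0) x0 f g"
    by (rule sph_homotopicI) (use h0 h1 hb in auto)
qed

lemma htpy_class_path_component:
  assumes "n \<ge> 1"
  shows "htpy_class n (path_component_space X x0) x0 = htpy_class n X x0"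
  by (simp add: fun_eq_iff htpy_class_def spheroids_path_component[OF assms]
      sph_homotopic_path_component[OF assms])

lemma homotopy_group_path_component:
  assumes n: "n \<ge> 1"
  shows "homotopy_group n (path_component_space X x0) x0 = homotopy_group n X x0"
  by (simp add: homotopy_group_def spheroids_path_component[OF n] htpy_class_path_component[OF n])

section \<open>Gottlieb groups\<close>

lemma eval_id_map: "z0 \<in> topspace Z \<Longrightarrow> id_map Z z0 = z0"
  by (simp add: id_map_def)

lemma gottlieb_group_eq:
  assumes n: "n \<ge> 1"
  shows "gottlieb_group n Z z0 = (homotopy_group n Z z0)\<lparr>carrier :=
           induced_hom n Z z0 (\<lambda>g. g z0) ` carrier (homotopy_group n (map_space Z Z) (id_map Z))\<rparr>"
  unfolding gottlieb_group_def aut1_def homotopy_group_path_component[OF n] ..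

lemma gottlieb_carrier:
  assumes n: "n \<ge> 1" and z0: "z0 \<in> topspace Z"
  shows "carrier (gottlieb_group n Z z0) =
    (\<lambda>F. htpy_class n Z z0 (push n (\<lambda>g. g z0) F)) ` spheroids n (map_space Z Z) (id_map Z)"
  using induced_hom_htpy_class[OF n continuous_map_eval_at[OF z0], where ?x0.0 = "id_map Z",
      OF eval_id_map[OF z0]]
  by (simp add: gottlieb_group_eq[OF n] homotopy_group_carrier image_image)

lemma gottlieb_mult: "x \<otimes>\<^bsub>gottlieb_group n Z z0\<^esub> y = x \<otimes>\<^bsub>homotopy_group n Z z0\<^esub> y"
  and gottlieb_one: "\<one>\<^bsub>gottlieb_group n Z z0\<^esub> = \<one>\<^bsub>homotopy_group n Z z0\<^esub>"
  by (simp_all add: gottlieb_group_def)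

lemma gottlieb_subgroup:
  assumes n: "n \<ge> 1" and z0: "z0 \<in> topspace Z"
  shows "subgroup (carrier (gottlieb_group n Z z0)) (homotopy_group n Z z0)"
proof -
  have "group_hom (homotopy_group n (map_space Z Z) (id_map Z)) (homotopy_group n Z z0)
      (induced_hom n Z z0 (\<lambda>g. g z0))"
    using n z0 by (auto simp: group_hom_def group_hom_axioms_def id_map_in_maps
        intro!: homotopy_group_is_group induced_hom_in_hom continuous_map_eval_at eval_id_map)
  from group_hom.img_is_subgroup[OF this] show ?thesis by (simp add: gottlieb_group_eq[OF n])
qed

text \<open>A family \<open>F\<close> of self-maps of \<open>Z\<close> turns two spheroids \<open>F\<close> evaluated at \<open>z0\<close> and \<open>g\<close> into one map
  \<open>(s, t) \<mapsto> F s (g t)\<close> on a product of two cubes. Both products of the spheroids are restrictions of it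
  along paths in the square of the two concatenation coordinates that run around the two sides
  of the diagonal, and these are homotopic by convexity.\<close>

lemma gottlieb_central:
  assumes n: "n \<ge> 1" and z0: "z0 \<in> topspace Z"
    and F: "F \<in> spheroids n (map_space Z Z) (id_map Z)" and g: "g \<in> spheroids n Z z0"
  shows "sph_homotopic n Z z0 (spheroid_concat n (push n (\<lambda>k. k z0) F) g)
           (spheroid_concat n g (push n (\<lambda>k. k z0) F))"
proof (rule sph_homotopicI)
  let ?I = unit_interval and ?P = "prod_topology unit_interval (cube n)"
  have Fb: "F s z = z" if "s \<in> cube_boundary n" "z \<in> topspace Z" for s z
    using that spheroid_boundary[OF F] by (simp add: id_map_def)
  \<comment> \<open>The space \<open>Z\<close> is arbitrary, but \<open>g\<close> has a locally compact domain; hence adjoints are taken only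
     after precomposing with \<open>g\<close>.\<close>
  have "continuous_map (cube n) (map_space (cube n) Z)
      (\<lambda>s. restrict (F s \<circ> g) (topspace (cube n)))"
    using continuous_map_compose[OF spheroid_continuous[OF F]
        continuous_map_precompose[OF spheroid_continuous[OF g]]] by (simp add: o_def)
  then have FgH: "continuous_map (prod_topology (cube n) (cube n)) Z
      (\<lambda>p. restrict (F (fst p) \<circ> g) (topspace (cube n)) (snd p))"
    by (rule continuous_map_uncurry[OF compact_Hausdorff_cube(3,2)])
  have Fg: "continuous_map (prod_topology (cube n) (cube n)) Z (\<lambda>p. F (fst p) (g (snd p)))"
    using FgH by (rule continuous_map_eq) auto
  \<comment> \<open>The path \<open>(p, q)\<close> runs first along one and then along the other side of the square, and \<open>(q, p)\<close>
     in the opposite order.\<close>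
  define p q :: "real \<Rightarrow> real" where "p x = min 1 (2 * x)" and "q x = max 0 (2 * x - 1)" for x
  have pq: "p x \<in> {0..1}" "q x \<in> {0..1}" if "x \<in> {0..1}" for x
    using that by (auto simp: p_def q_def)
  let ?u = "\<lambda>w. (1 - fst w) * p (snd w 0) + fst w * q (snd w 0)"
  let ?v = "\<lambda>w. (1 - fst w) * q (snd w 0) + fst w * p (snd w 0)"
  let ?h = "\<lambda>w. F ((snd w)(0 := ?u w)) (g ((snd w)(0 := ?v w)))"
  have c0: "continuous_map ?P ?I (\<lambda>w. snd w 0)"
    using n by (intro continuous_map_coord[OF continuous_map_snd]) auto
  have cp: "continuous_map ?P ?I (\<lambda>w. p (snd w 0))" and cq: "continuous_map ?P ?I (\<lambda>w. q (snd w 0))"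
    by (rule continuous_map_unit_compose[OF _ _ c0];
        auto simp: p_def q_def intro!: continuous_intros)+
  have "continuous_map ?P (cube n) (\<lambda>w. (snd w)(0 := ?u w))"
    "continuous_map ?P (cube n) (\<lambda>w. (snd w)(0 := ?v w))"
    using n by (intro continuous_map_update[OF continuous_map_snd]
        continuous_map_unit_lerp[OF continuous_map_fst] cp cq; simp)+
  then have "continuous_map ?P (prod_topology (cube n) (cube n))
      (\<lambda>w. ((snd w)(0 := ?u w), (snd w)(0 := ?v w)))"
    by (simp add: continuous_map_pairwise o_def)
  from continuous_map_compose[OF this Fg] show "continuous_map ?P Z ?h" by (simp add: o_def)
  have top: "s(0 := x) \<in> topspace (cube n)" if "s \<in> topspace (cube n)" "x \<in> {0..1}" for s x
    using n that by (intro cube_update) auto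
  have g0: "g (s(0 := 0)) = z0" "g (s(0 := 1)) = z0" if "s \<in> topspace (cube n)" for s
    using that n by (auto simp: spheroid_face[OF g])
  have F0: "F (s(0 := 0)) z = z" "F (s(0 := 1)) z = z"
    if "s \<in> topspace (cube n)" "z \<in> topspace Z" for s z
    using that n by (auto intro!: Fb cube_boundary_updateI)
  have gtop: "g (s(0 := x)) \<in> topspace Z" if "s \<in> topspace (cube n)" "x \<in> {0..1}" for s x
    using that top by (intro spheroid_apply[OF g])
  show "?h (0, s) = spheroid_concat n (push n (\<lambda>k. k z0) F) g s"
    "?h (1, s) = spheroid_concat n g (push n (\<lambda>k. k z0) F) s" if s: "s \<in> topspace (cube n)" for s
  proof -
    have s0: "s 0 \<in> {0..1}" using s n cube_coord[of s n 0] by auto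
    have "p (s 0) = 2 * s 0 \<and> q (s 0) = 0" if "s 0 \<le> 1/2" using that by (simp add: p_def q_def)
    moreover have "p (s 0) = 1 \<and> q (s 0) = 2 * s 0 - 1" if "\<not> s 0 \<le> 1/2"
      using that by (simp add: p_def q_def)
    ultimately show "?h (0, s) = spheroid_concat n (push n (\<lambda>k. k z0) F) g s"
      "?h (1, s) = spheroid_concat n g (push n (\<lambda>k. k z0) F) s"
      using s s0 g0[OF s] F0[OF s] top[OF s] gtop[OF s] by (auto simp: spheroid_concat_def)
  qed
  show "?h (t, s) = z0" if t: "t \<in> {0..1}" and s: "s \<in> cube_boundary n" for t s
  proof -
    have s0: "s 0 \<in> {0..1}" using s n cube_boundary_subset cube_coord[of s n 0] by auto
    have uI: "?u (t, s) \<in> {0..1}" and vI: "?v (t, s) \<in> {0..1}"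
      using convex_combination_unit[OF t pq(1)[OF s0] pq(2)[OF s0]] convex_combination_unit[OF t pq(2)[OF s0] pq(1)[OF s0]]
      by auto
    have "?u (t, s) = 0 \<or> ?u (t, s) = 1" "?v (t, s) = 0 \<or> ?v (t, s) = 1" if "s 0 = 0 \<or> s 0 = 1"
      using that by (auto simp: p_def q_def)
    then have "s(0 := ?u (t, s)) \<in> cube_boundary n" "s(0 := ?v (t, s)) \<in> cube_boundary n"
      using n uI vI by (auto intro!: cube_boundary_update[OF s] simp del: atLeastAtMost_iff)
    then show ?thesis
      using Fb z0 spheroid_boundary[OF g] by simp
  qed
qed

lemma gottlieb_comm_group:
  assumes n: "n \<ge> 1" and z0: "z0 \<in> topspace Z"
  shows "comm_group (gottlieb_group n Z z0)"
proof (rule group.group_comm_groupI)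
  show "group (gottlieb_group n Z z0)"
    using subgroup.subgroup_is_group[OF gottlieb_subgroup[OF n z0] homotopy_group_is_group[OF n z0]]
    by (simp add: gottlieb_group_eq[OF n])
  fix A B assume "A \<in> carrier (gottlieb_group n Z z0)" "B \<in> carrier (gottlieb_group n Z z0)"
  then obtain F G where F: "F \<in> spheroids n (map_space Z Z) (id_map Z)"
      "A = htpy_class n Z z0 (push n (\<lambda>k. k z0) F)"
    and G: "G \<in> spheroids n (map_space Z Z) (id_map Z)"
      "B = htpy_class n Z z0 (push n (\<lambda>k. k z0) G)"
    unfolding gottlieb_carrier[OF n z0] by blast
  have FG: "push n (\<lambda>k. k z0) F \<in> spheroids n Z z0" "push n (\<lambda>k. k z0) G \<in> spheroids n Z z0"
    using F(1) G(1)
    by (auto intro!: push_spheroid[OF n continuous_map_eval_at[OF z0], where ?x0.0 = "id_map Z"]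
        eval_id_map[OF z0])
  then have "A \<otimes>\<^bsub>homotopy_group n Z z0\<^esub> B = B \<otimes>\<^bsub>homotopy_group n Z z0\<^esub> A"
    unfolding F(2) G(2) homotopy_group_mult[OF n FG] homotopy_group_mult[OF n FG(2,1)]
    by (subst htpy_class_eq_iff) (use n gottlieb_central[OF n z0 F(1) FG(2)] in \<open>auto intro: concat_spheroid\<close>)
  then show "A \<otimes>\<^bsub>gottlieb_group n Z z0\<^esub> B = B \<otimes>\<^bsub>gottlieb_group n Z z0\<^esub> A"
    by (simp add: gottlieb_group_eq[OF n])
qed

section \<open>Loops as functions of a real parameter\<close>

abbreviation loop_space :: "'a topology \<Rightarrow> (complex \<Rightarrow> 'a) topology" where
  "loop_space X \<equiv> map_space circle X"

definition turn_to :: "real \<Rightarrow> complex" where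
  "turn_to t = cis (2 * pi * t)"

text \<open>At the point 1 of the circle this choice may be 0 or 1. By \<open>turn_of_turn_to\<close> that is immaterial for
  functions on the interval that have equal values at the ends.\<close>

definition turn_of :: "complex \<Rightarrow> real" where
  "turn_of z = (SOME t. t \<in> {0..1} \<and> turn_to t = z)"

lemma turn_to_circle: "turn_to t \<in> sphere 0 1"
  by (simp add: turn_to_def)

lemma turn_to_ends: "turn_to 0 = 1" "turn_to 1 = 1"
  by (simp_all add: turn_to_def cis_2pi)

lemma turn_of: 
  assumes "z \<in> sphere 0 1" shows "turn_of z \<in> {0..1}" "turn_to (turn_of z) = z"
proof -
  from assms have "norm z = 1" by simp
  then obtain \<theta> where \<theta>: "0 \<le> \<theta>" "\<theta> < 2 * pi" "z = cis \<theta>"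
    by (metis complex_unimodular_polar cis_conv_exp cis.code complex_eq_iff cis.sel)
  then have "\<exists>t. t \<in> {0..1} \<and> turn_to t = z"
    by (intro exI[of _ "\<theta> / (2 * pi)"]) (simp add: turn_to_def)
  then have "turn_of z \<in> {0..1} \<and> turn_to (turn_of z) = z"
    unfolding turn_of_def by (rule someI_ex)
  then show "turn_of z \<in> {0..1}" "turn_to (turn_of z) = z" by auto
qed

lemma turn_to_eqD:
  assumes "turn_to s = turn_to t" "s \<in> {0..1}" "t \<in> {0..1}"
  shows "s = t \<or> (s = 0 \<and> t = 1) \<or> (s = 1 \<and> t = 0)"
proof -
  have "sin (2 * pi * s) = sin (2 * pi * t) \<and> cos (2 * pi * s) = cos (2 * pi * t)"
    using assms(1) by (simp add: turn_to_def complex_eq_iff)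
  then obtain m :: int where "2 * pi * s = 2 * pi * t + 2 * pi * m"
    using sin_cos_eq_iff by metis
  then have "2 * pi * s = 2 * pi * (t + m)" by (simp add: algebra_simps)
  then have m: "s = t + m" by simp
  then have "\<bar>real_of_int m\<bar> \<le> 1" using assms(2,3) by auto
  then have "m = -1 \<or> m = 0 \<or> m = 1" by linarith
  with m assms(2,3) show ?thesis by auto
qed

lemma turn_of_turn_to:
  assumes p: "p 0 = p 1" and t: "t \<in> {0..1}"
  shows "p (turn_of (turn_to t)) = p t"
  using turn_to_eqD[OF turn_of(2)[OF turn_to_circle] turn_of(1)[OF turn_to_circle] t] p by auto

lemma continuous_map_turn_to: "continuous_map unit_interval circle turn_to"
proof -
  have "continuous_on {0..1} turn_to" unfolding turn_to_def by (intro continuous_intros)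
  then show ?thesis using turn_to_circle by (auto simp: continuous_map_in_subtopology)
qed

text \<open>Multiplying with the closed surjection from the interval to the circle gives a quotient map
  for every parameter space, because that surjection is proper.\<close>

lemma quotient_map_turn_to:
  "quotient_map (prod_topology A unit_interval) (prod_topology A circle) (\<lambda>(a, t). (a, turn_to t))"
proof (rule continuous_closed_imp_quotient_map)
  have "proper_map unit_interval circle turn_to"
    by (intro continuous_imp_proper_map continuous_map_turn_to)
       (auto simp: compact_space_subtopology circle_props Hausdorff_imp_kc_space)
  then have "proper_map (prod_topology A unit_interval) (prod_topology A circle)
      (\<lambda>(a, t). (a, turn_to t))"
    using proper_map_prod[of A unit_interval A circle "\<lambda>a. a" turn_to]
      proper_map_id[unfolded id_def] by blast
  then show "closed_map (prod_topology A unit_interval) (prod_topology A circle)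
      (\<lambda>(a, t). (a, turn_to t))" by (simp add: proper_map_def)
  show "continuous_map (prod_topology A unit_interval) (prod_topology A circle)
      (\<lambda>(a, t). (a, turn_to t))"
    using continuous_map_compose[OF continuous_map_snd continuous_map_turn_to]
    by (simp add: continuous_map_pairwise o_def split_beta continuous_map_fst)
  show "(\<lambda>(a, t). (a, turn_to t)) ` topspace (prod_topology A unit_interval)
      = topspace (prod_topology A circle)"
  proof
    show "topspace (prod_topology A circle)
        \<subseteq> (\<lambda>(a, t). (a, turn_to t)) ` topspace (prod_topology A unit_interval)"
    proof
      fix p assume "p \<in> topspace (prod_topology A circle)"
      then have "p = (\<lambda>(a, t). (a, turn_to t)) (fst p, turn_of (snd p))"
        "(fst p, turn_of (snd p)) \<in> topspace (prod_topology A unit_interval)"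
        using turn_of[of "snd p"] by auto
      then show "p \<in> (\<lambda>(a, t). (a, turn_to t)) ` topspace (prod_topology A unit_interval)"
        by (rule image_eqI)
    qed
  qed (use turn_to_circle in auto)
qed

abbreviation loop_of :: "(real \<Rightarrow> 'a) \<Rightarrow> complex \<Rightarrow> 'a" where
  "loop_of p \<equiv> (\<lambda>z\<in>topspace circle. p (turn_of z))"

text \<open>A family of closed paths in a real parameter is the same as a family of loops; closedness for each
  \<open>a\<close> is what lets \<open>P\<close> descend to the quotient.\<close>

lemma continuous_map_loop_of:
  assumes P: "continuous_map (prod_topology A unit_interval) X P"
    and ends: "\<And>a. a \<in> topspace A \<Longrightarrow> P (a, 0) = P (a, 1)"
  shows "continuous_map A (loop_space X) (\<lambda>a. loop_of (\<lambda>t. P (a, t)))"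
proof -
  \<comment> \<open>Composed with the quotient map this is \<open>P\<close>, by the condition on the ends.\<close>
  have "continuous_map (prod_topology A unit_interval) X
      ((\<lambda>p. P (fst p, turn_of (snd p))) \<circ> (\<lambda>(a, t). (a, turn_to t)))"
    using P by (rule continuous_map_eq)
      (auto simp: ends intro!: turn_of_turn_to[where p = "\<lambda>t. P (_, t)", symmetric])
  from continuous_compose_quotient_map[OF quotient_map_turn_to this]
  have "continuous_map (prod_topology A circle) X (\<lambda>p. P (fst p, turn_of (snd p)))" .
  from continuous_map_curry[OF this] show ?thesis by simp
qed

lemma continuous_map_loop_at:
  assumes "continuous_map W (loop_space X) \<Phi>" "continuous_map W unit_interval u"
  shows "continuous_map W X (\<lambda>w. \<Phi> w (turn_to (u w)))"
  using continuous_map_compose[OF assms(2) continuous_map_turn_to]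
  by (intro continuous_map_evaluation[OF circle_props(3,2) assms(1)]) (simp add: o_def)

section \<open>Adding a coordinate to a cube\<close>

lemma continuous_map_cube_append:
  assumes "continuous_map W (cube n) f" "continuous_map W unit_interval u"
  shows "continuous_map W (cube (Suc n)) (\<lambda>w. (f w)(n := u w))"
  using assms by (auto simp: continuous_map_into_cube extensional_def Pi_iff less_Suc_eq)

lemma continuous_map_cube_init:
  assumes "continuous_map W (cube (Suc n)) f"
  shows "continuous_map W (cube n) (\<lambda>w. restrict (f w) {..<n})"
  using assms by (auto simp: continuous_map_into_cube)

lemma cube_append:
  "s \<in> topspace (cube n) \<Longrightarrow> t \<in> {0..1} \<Longrightarrow> s(n := t) \<in> topspace (cube (Suc n))"
  by (auto simp: topspace_cube PiE_iff extensional_def less_Suc_eq)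

lemma cube_init: "s \<in> topspace (cube (Suc n)) \<Longrightarrow> restrict s {..<n} \<in> topspace (cube n)"
  by (auto simp: topspace_cube PiE_iff)

lemma cube_append_init:
  assumes "s \<in> topspace (cube (Suc n))"
  shows "(restrict s {..<n})(n := s n) = s"
  using assms by (auto simp: topspace_cube PiE_iff extensional_def fun_eq_iff)

lemma cube_boundary_append:
  "s \<in> cube_boundary n \<Longrightarrow> t \<in> {0..1} \<Longrightarrow> s(n := t) \<in> cube_boundary (Suc n)"
proof -
  assume s: "s \<in> cube_boundary n" and t: "t \<in> {0..1}"
  then obtain i where "i < n" "s i = 0 \<or> s i = 1" "s \<in> topspace (cube n)"
    by (auto simp: cube_boundary_def)
  then show ?thesis by (intro cube_boundaryI[of _ _ i] cube_append t) auto
qed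

lemma cube_append_turn:
  "s \<in> topspace (cube n) \<Longrightarrow> norm z = 1 \<Longrightarrow> s(n := turn_of z) \<in> topspace (cube (Suc n))"
  by (intro cube_append turn_of) simp_all

lemma cube_boundary_append_turn:
  "s \<in> cube_boundary n \<Longrightarrow> norm z = 1 \<Longrightarrow> s(n := turn_of z) \<in> cube_boundary (Suc n)"
  by (intro cube_boundary_append turn_of) simp_all

lemma cube_boundary_cases:
  assumes "s \<in> cube_boundary (Suc n)"
  obtains "restrict s {..<n} \<in> cube_boundary n" | "s n = 0" | "s n = 1"
proof -
  obtain i where i: "i < Suc n" "s i = 0 \<or> s i = 1" and s: "s \<in> topspace (cube (Suc n))"
    using assms by (auto simp: cube_boundary_def)
  show ?thesis
  proof (cases "i = n")
    case False
    then have "restrict s {..<n} \<in> cube_boundary n"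
      using i by (intro cube_boundaryI[of _ _ i] cube_init s) auto
    then show ?thesis by (rule that(1))
  qed (use i that in auto)
qed

section \<open>Homotopy groups of the free loop space\<close>

text \<open>The last coordinate of a spheroid of \<open>X\<close> of degree \<open>n + 1\<close> becomes the loop parameter. Since
  concatenation uses coordinate 0, this is compatible with concatenation for \<open>n \<ge> 1\<close>.\<close>

definition loop_spheroid :: "nat \<Rightarrow> ((nat \<Rightarrow> real) \<Rightarrow> 'a) \<Rightarrow> (nat \<Rightarrow> real) \<Rightarrow> complex \<Rightarrow> 'a" where
  "loop_spheroid n b = (\<lambda>s\<in>topspace (cube n). loop_of (\<lambda>t. b (s(n := t))))"

lemma loop_spheroid_homotopic:
  assumes bc: "sph_homotopic (Suc n) X x0 b c"
  shows "sph_homotopic n (loop_space X) (const_map circle x0) (loop_spheroid n b) (loop_spheroid n c)"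
proof -
  let ?A = "prod_topology unit_interval (cube n)"
  obtain h where h: "continuous_map (prod_topology unit_interval (cube (Suc n))) X h"
    and h0: "\<And>s. s \<in> topspace (cube (Suc n)) \<Longrightarrow> h (0, s) = b s"
    and h1: "\<And>s. s \<in> topspace (cube (Suc n)) \<Longrightarrow> h (1, s) = c s"
    and hb: "\<And>t s. t \<in> {0..1} \<Longrightarrow> s \<in> cube_boundary (Suc n) \<Longrightarrow> h (t, s) = x0"
    using bc by (rule sph_homotopicE) blast
  let ?P = "\<lambda>p. h (fst (fst p), (snd (fst p))(n := snd p))"
  have "continuous_map (prod_topology ?A unit_interval) (prod_topology unit_interval (cube (Suc n)))
      (\<lambda>p. (fst (fst p), (snd (fst p))(n := snd p)))"
    unfolding continuous_map_pairwise o_def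
    by (auto intro!: continuous_map_cube_append continuous_map_snd
        continuous_map_compose[OF continuous_map_fst continuous_map_fst, unfolded o_def]
        continuous_map_compose[OF continuous_map_fst continuous_map_snd, unfolded o_def])
  from continuous_map_compose[OF this h]
  have P: "continuous_map (prod_topology ?A unit_interval) X ?P" by (simp add: o_def)
  have hn: "h (t, s(n := x)) = x0" if "t \<in> {0..1}" "s \<in> topspace (cube n)" "x = 0 \<or> x = 1" for t s x
    using that by (intro hb cube_boundaryI[of _ _ n] cube_append) auto
  have c: "continuous_map ?A (loop_space X) (\<lambda>a. loop_of (\<lambda>t. ?P (a, t)))"
    by (rule continuous_map_loop_of[OF P]) (auto simp: hn)
  show ?thesis
  proof (rule sph_homotopicI[OF c])
    fix s assume s: "s \<in> topspace (cube n)"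
    then show "loop_of (\<lambda>t. ?P ((0, s), t)) = loop_spheroid n b s"
      "loop_of (\<lambda>t. ?P ((1, s), t)) = loop_spheroid n c s"
      by (auto simp: loop_spheroid_def h0 h1 cube_append_turn)
  next
    fix t s assume "t \<in> {0..1::real}" "s \<in> cube_boundary n"
    then show "loop_of (\<lambda>x. ?P ((t, s), x)) = const_map circle x0"
      by (auto simp: const_map_def hb cube_boundary_append_turn)
  qed
qed

lemma loop_spheroid_concat:
  assumes n: "n \<ge> 1"
  shows "loop_spheroid n (spheroid_concat (Suc n) f g)
           = spheroid_concat n (loop_spheroid n f) (loop_spheroid n g)"
proof
  fix s
  show "loop_spheroid n (spheroid_concat (Suc n) f g) s
      = spheroid_concat n (loop_spheroid n f) (loop_spheroid n g) s"
  proof (cases "s \<in> topspace (cube n)")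
    case True
    then have s0: "s 0 \<in> {0..1}" using n cube_coord by auto
    have 1: "s(0 := 2 * s 0) \<in> topspace (cube n)" if "s 0 \<le> 1/2"
      using True n s0 that by (auto intro!: cube_update)
    have 2: "s(0 := 2 * s 0 - 1) \<in> topspace (cube n)" if "\<not> s 0 \<le> 1/2"
      using True n s0 that by (auto intro!: cube_update)
    have 3: "s(n := turn_of z) \<in> topspace (cube (Suc n))" if "norm z = 1" for z
      using True that by (rule cube_append_turn)
    have 4: "s(n := t, 0 := x) = s(0 := x, n := t)" for t x
      using n by (intro fun_upd_twist) auto
    show ?thesis
      using True n 1 2 3 4
      by (cases "s 0 \<le> 1/2") (auto simp: spheroid_concat_def loop_spheroid_def intro!: restrict_ext)
  qed (simp add: loop_spheroid_def spheroid_concat_def)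
qed

lemma loop_spheroid_op:
  assumes n: "n \<ge> 1"
  shows "spheroid_op (Suc n) X x0 n (loop_space X) (const_map circle x0) (loop_spheroid n)"
  unfolding spheroid_op_def
proof (intro ballI conjI impI loop_spheroid_concat[OF n])
  fix b assume b: "b \<in> spheroids (Suc n) X x0"
  then have "sph_homotopic n (loop_space X) (const_map circle x0) (loop_spheroid n b) (loop_spheroid n b)"
    by (intro loop_spheroid_homotopic sph_homotopic_refl)
  then have "restrict (loop_spheroid n b) (topspace (cube n))
      \<in> spheroids n (loop_space X) (const_map circle x0)"
    by (intro restrict_spheroid) auto
  then show "loop_spheroid n b \<in> spheroids n (loop_space X) (const_map circle x0)"
    by (simp add: loop_spheroid_def)
qed (rule loop_spheroid_homotopic)

lemma loop_spheroid_spheroid: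
  "n \<ge> 1 \<Longrightarrow> b \<in> spheroids (Suc n) X x0 \<Longrightarrow>
     loop_spheroid n b \<in> spheroids n (loop_space X) (const_map circle x0)"
  using loop_spheroid_op[of n X x0] by (simp add: spheroid_op_def)

lemma continuous_map_const_map: "continuous_map X (map_space A X) (const_map A)"
  using continuous_map_curry[OF continuous_map_fst, of X A] by (simp add: const_map_def[abs_def])

lemma push_const_spheroid:
  "n \<ge> 1 \<Longrightarrow> f \<in> spheroids n X x0 \<Longrightarrow>
     push n (const_map circle) f \<in> spheroids n (loop_space X) (const_map circle x0)"
  by (rule push_spheroid[OF _ continuous_map_const_map refl])

lemma continuous_map_base_point: "continuous_map (loop_space X) X (\<lambda>l. l 1)"
  by (rule continuous_map_eval_at) simp

lemma base_point_const: "const_map circle x 1 = x"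
  by (simp add: const_map_def)

lemma base_point_push_const:
  assumes f: "f \<in> spheroids n X x0"
  shows "push n (\<lambda>l. l 1) (push n (const_map circle) f) = f"
proof -
  have "f \<in> extensional (topspace (cube n))" using spheroid_in_maps[OF f] by (simp add: maps_def)
  then show ?thesis by (auto simp: const_map_def extensional_def fun_eq_iff)
qed

lemma base_point_loop_spheroid:
  assumes b: "b \<in> spheroids (Suc n) X x0"
  shows "push n (\<lambda>l. l 1) (loop_spheroid n b) = const_map (cube n) x0"
proof -
  have "b (s(n := turn_of 1)) = x0" if s: "s \<in> topspace (cube n)" for s
  proof -
    have "s(n := 0) \<in> topspace (cube (Suc n))" using s by (intro cube_append) auto
    then have 0: "b (s(n := 0)) = x0" "b (s(n := 1)) = x0"
      using spheroid_face[OF b, of "s(n := 0)" n] by auto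
    then show ?thesis
      using turn_of_turn_to[of "\<lambda>t. b (s(n := t))" 0] by (simp add: turn_to_ends)
  qed
  then show ?thesis by (auto simp: loop_spheroid_def const_map_def)
qed

text \<open>The path \<open>t \<mapsto> (detour t, middle t)\<close> in the unit square runs from \<open>(0, 0)\<close> to \<open>(0, 1)\<close> along the
  three other sides, through \<open>(1, 0)\<close> and \<open>(1, 1)\<close>, instead of along the direct side. It serves to turn a family of loops
  with moving base points into a family of based loops: the first coordinate moves the base point out
  and back, the second one traverses the loop.\<close>

definition detour :: "real \<Rightarrow> real" where
  "detour t = min 1 (min (3 * t) (3 - 3 * t))"

definition middle :: "real \<Rightarrow> real" where
  "middle t = min 1 (max 0 (3 * t - 1))"

lemma continuous_on_detour: "continuous_on S detour"
  unfolding detour_def by (intro continuous_intros)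

lemma continuous_on_middle: "continuous_on S middle"
  unfolding middle_def by (intro continuous_intros)

lemma detour_unit: "t \<in> {0..1} \<Longrightarrow> detour t \<in> {0..1}"
  by (auto simp: detour_def)

lemma middle_unit: "middle t \<in> {0..1}"
  by (auto simp: middle_def)

lemma detour_middle_ends: "detour 0 = 0" "detour 1 = 0" "middle 0 = 0" "middle 1 = 1"
  by (simp_all add: detour_def middle_def)

lemma detour_or_middle: "detour t = 1 \<or> middle t = 0 \<or> middle t = 1"
  by (auto simp: detour_def middle_def min_def max_def)

lemma continuous_map_unit_mult:
  assumes "continuous_map W unit_interval u" "continuous_map W unit_interval v"
  shows "continuous_map W unit_interval (\<lambda>w. u w * v w)"
  using continuous_map_unit_lerp[OF assms(1) continuous_map_constI[of 0 unit_interval] assms(2)]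
  by simp

lemma continuous_map_pairI:
  "continuous_map W X f \<Longrightarrow> continuous_map W Y g \<Longrightarrow> continuous_map W (prod_topology X Y) (\<lambda>w. (f w, g w))"
  by (simp add: continuous_map_pairwise o_def)

text \<open>A null-homotopy of free loops gives a map \<open>K \<tau> s t\<close> that is \<open>b\<close> for \<open>\<tau> = 0\<close> and constant for
  \<open>\<tau> = 1\<close>, but the base points \<open>K \<tau> s 0 = K \<tau> s 1\<close> may move in between. For fixed \<open>s\<close> the direct side of
  the square of the coordinates \<open>\<tau>\<close> and \<open>t\<close> deforms, with fixed ends, into the detour along the other three sides. On
  those, \<open>K\<close> only follows the base points out and back, and such a path contracts.\<close>

lemma loop_spheroid_inj:
  assumes b: "b \<in> spheroids (Suc n) X x0"
    and triv: "sph_homotopic n (loop_space X) (const_map circle x0)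
                 (loop_spheroid n b) (const_map (cube n) (const_map circle x0))"
  shows "sph_homotopic (Suc n) X x0 b (const_map (cube (Suc n)) x0)"
proof -
  let ?I = unit_interval
  let ?A = "prod_topology ?I (cube n)" and ?W = "prod_topology ?I (cube (Suc n))"
  obtain h where h: "continuous_map ?A (loop_space X) h"
    and h0: "\<And>s. s \<in> topspace (cube n) \<Longrightarrow> h (0, s) = loop_spheroid n b s"
    and h1: "\<And>s. s \<in> topspace (cube n) \<Longrightarrow> h (1, s) = const_map (cube n) (const_map circle x0) s"
    and hb: "\<And>t s. t \<in> {0..1} \<Longrightarrow> s \<in> cube_boundary n \<Longrightarrow> h (t, s) = const_map circle x0"
    using triv by (rule sph_homotopicE) blast
  define K where "K \<tau> s t = h (\<tau>, restrict s {..<n}) (turn_to t)" for \<tau> t and s :: "nat \<Rightarrow> real"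
  have K: "continuous_map ?W X (\<lambda>w. K (u w) (snd w) (v w))"
    if "continuous_map ?W ?I u" "continuous_map ?W ?I v" for u v
    unfolding K_def
    by (intro continuous_map_loop_at[OF continuous_map_compose[OF _ h, unfolded o_def] that(2)]
        continuous_map_pairI that(1) continuous_map_cube_init[OF continuous_map_snd])
  have K0: "K 0 s t = b (s(n := t))" if s: "s \<in> topspace (cube (Suc n))" and t: "t \<in> {0..1}" for s t
  proof -
    have "b (s(n := 0)) = b (s(n := 1))"
      using spheroid_face[OF b s, of n] by simp
    moreover have "(restrict s {..<n})(n := x) = s(n := x)" for x
      using cube_append_init[OF s] by (metis fun_upd_upd)
    ultimately show ?thesis
      using turn_of_turn_to[of "\<lambda>t. b (s(n := t))" t] t turn_to_circle[of t] cube_init[OF s]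
      by (simp add: K_def h0 loop_spheroid_def)
  qed
  have K1: "K 1 s t = x0" if "s \<in> topspace (cube (Suc n))" for s t
    using turn_to_circle[of t] cube_init[OF that] by (simp add: K_def h1 const_map_def)
  have Kb: "K \<tau> s t = x0" if "\<tau> \<in> {0..1}" "restrict s {..<n} \<in> cube_boundary n" for \<tau> s t
    using turn_to_circle[of t] hb[OF that] by (simp add: K_def const_map_def)
  have Kends: "K \<tau> s 1 = K \<tau> s 0" for \<tau> s
    by (simp add: K_def turn_to_ends)
  have cn: "continuous_map ?W ?I (\<lambda>w. snd w n)"
    by (intro continuous_map_coord[OF continuous_map_snd]) simp
  have cd: "continuous_map ?W ?I (\<lambda>w. detour (snd w n))"
    by (intro continuous_map_unit_compose[OF continuous_on_detour _ cn] detour_unit)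
  have cm: "continuous_map ?W ?I (\<lambda>w. middle (snd w n))"
    by (intro continuous_map_unit_compose[OF continuous_on_middle _ cn] middle_unit)
  have H1: "sph_homotopic (Suc n) X x0 b (\<lambda>s. K (detour (s n)) s (middle (s n)))"
  proof (rule sph_homotopicI)
    let ?G = "\<lambda>w. K (fst w * detour (snd w n)) (snd w) ((1 - fst w) * snd w n + fst w * middle (snd w n))"
    show "continuous_map ?W X ?G"
      by (intro K continuous_map_unit_mult continuous_map_unit_lerp continuous_map_fst cn cd cm)
    fix s assume s: "s \<in> topspace (cube (Suc n))"
    then show "?G (0, s) = b s" using cube_coord[of s "Suc n" n] by (simp add: K0)
    show "?G (1, s) = K (detour (s n)) s (middle (s n))" by simp
  next
    fix t s assume t: "t \<in> {0..1::real}" and s: "s \<in> cube_boundary (Suc n)"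
    have st: "s \<in> topspace (cube (Suc n))" using s cube_boundary_subset by auto
    have b0: "b (s(n := 0)) = x0" using spheroid_face[OF b st, of n] by simp
    show "K (fst (t, s) * detour (snd (t, s) n)) (snd (t, s))
        ((1 - fst (t, s)) * snd (t, s) n + fst (t, s) * middle (snd (t, s) n)) = x0"
      using s
    proof (cases rule: cube_boundary_cases)
      case 1
      have "t * detour (s n) \<in> {0..1}"
        using t detour_unit[OF cube_coord[OF st, of n]] by (auto intro: mult_le_one)
      with 1 show ?thesis by (simp add: Kb)
    next
      case 2
      then show ?thesis using b0 by (simp add: detour_middle_ends K0[OF st])
    next
      case 3
      then show ?thesis using b0 by (simp add: detour_middle_ends Kends K0[OF st])
    qed
  qed
  have H2: "sph_homotopic (Suc n) X x0 (const_map (cube (Suc n)) x0)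
      (\<lambda>s. K (detour (s n)) s (middle (s n)))"
  proof (rule sph_homotopicI)
    \<comment> \<open>On the detour the loop coordinate may be replaced by 0: it is 0 or 1, or else \<open>K\<close> is
       constant.\<close>
    let ?G = "\<lambda>w. K (fst w * detour (snd w n)) (snd w) 0"
    show "continuous_map ?W X ?G"
      by (intro K continuous_map_unit_mult continuous_map_fst cd) simp
    fix s assume s: "s \<in> topspace (cube (Suc n))"
    have b0: "b (s(n := 0)) = x0" using spheroid_face[OF b s, of n] by simp
    then show "?G (0, s) = const_map (cube (Suc n)) x0 s"
      using s by (simp add: K0 const_map_def)
    show "?G (1, s) = K (detour (s n)) s (middle (s n))"
      using detour_or_middle[of "s n"] K1[OF s] Kends by auto
  next
    fix t s assume t: "t \<in> {0..1::real}" and s: "s \<in> cube_boundary (Suc n)"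
    have st: "s \<in> topspace (cube (Suc n))" using s cube_boundary_subset by auto
    have b0: "b (s(n := 0)) = x0" using spheroid_face[OF b st, of n] by simp
    show "K (fst (t, s) * detour (snd (t, s) n)) (snd (t, s)) 0 = x0"
      using s
    proof (cases rule: cube_boundary_cases)
      case 1
      have "t * detour (s n) \<in> {0..1}"
        using t detour_unit[OF cube_coord[OF st, of n]] by (auto intro: mult_le_one)
      with 1 show ?thesis by (simp add: Kb)
    qed (use b0 in \<open>simp_all add: detour_middle_ends K0[OF st]\<close>)
  qed
  show ?thesis by (rule homotopic_with_trans[OF H1 homotopic_with_symD[OF H2]])
qed

text \<open>Let \<open>h\<close> be a null-homotopy of the base points of the loops \<open>\<Phi> s\<close>. The based loop \<open>b\<close> goes out along
  \<open>h\<close>, then around \<open>\<Phi> s\<close>, then back along \<open>h\<close>. As free loops, these can be deformed to \<open>\<Phi> s\<close> by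
  shortening the way out: the loop \<open>B r s\<close> starts at stage \<open>r\<close> of \<open>h\<close>.\<close>

lemma loop_spheroid_exact:
  assumes n: "n \<ge> 1" and \<Phi>: "\<Phi> \<in> spheroids n (loop_space X) (const_map circle x0)"
    and triv: "sph_homotopic n X x0 (const_map (cube n) x0) (push n (\<lambda>l. l 1) \<Phi>)"
  obtains b where "b \<in> spheroids (Suc n) X x0"
    "sph_homotopic n (loop_space X) (const_map circle x0) (loop_spheroid n b) \<Phi>"
proof -
  let ?I = unit_interval and ?c0 = "const_map circle x0"
  let ?A = "prod_topology ?I (cube n)"
  let ?W = "prod_topology ?A ?I"
  obtain h where h: "continuous_map ?A X h"
    and h0: "\<And>s. s \<in> topspace (cube n) \<Longrightarrow> h (0, s) = const_map (cube n) x0 s"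
    and h1: "\<And>s. s \<in> topspace (cube n) \<Longrightarrow> h (1, s) = push n (\<lambda>l. l 1) \<Phi> s"
    and hb: "\<And>t s. t \<in> {0..1} \<Longrightarrow> s \<in> cube_boundary n \<Longrightarrow> h (t, s) = x0"
    using triv by (rule sph_homotopicE) blast
  have \<Phi>b: "\<Phi> s (turn_to t) = x0" if "s \<in> cube_boundary n" for s t
    using spheroid_boundary[OF \<Phi> that] turn_to_circle[of t] by (simp add: const_map_def)
  have h1': "h (1, s) = \<Phi> s 1" if "s \<in> topspace (cube n)" for s
    using h1[OF that] that by simp
  define B where "B r s t = (if 1 \<le> min (3 * t) (3 - 3 * t) then \<Phi> s (turn_to (middle t))
      else h (max r (detour t), s))" for r t :: real and s :: "nat \<Rightarrow> real"
  have ct: "continuous_map ?W ?I snd" by (rule continuous_map_snd)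
  have cl: "continuous_map ?W ?I (\<lambda>w. fst (fst w))" and cs: "continuous_map ?W (cube n) (\<lambda>w. snd (fst w))"
    using continuous_map_compose[OF continuous_map_fst continuous_map_fst]
      continuous_map_compose[OF continuous_map_fst continuous_map_snd] by (auto simp: o_def)
  have c\<Phi>: "continuous_map ?W (loop_space X) (\<lambda>w. \<Phi> (snd (fst w)))"
    using continuous_map_compose[OF cs spheroid_continuous[OF \<Phi>]] by (simp add: o_def)
  have cm: "continuous_map ?W ?I (\<lambda>w. middle (snd w))"
    by (intro continuous_map_unit_compose[OF continuous_on_middle _ ct] middle_unit)
  have cd: "continuous_map ?W ?I (\<lambda>w. detour (snd w))"
    by (intro continuous_map_unit_compose[OF continuous_on_detour _ ct] detour_unit)
  have cmax: "continuous_map ?W ?I (\<lambda>w. max (fst (fst w)) (detour (snd w)))"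
    using cl cd unfolding continuous_map_unit_real by (auto intro!: continuous_intros simp: le_max_iff_disj)
  have cB: "continuous_map ?W X (\<lambda>w. B (fst (fst w)) (snd (fst w)) (snd w))"
    unfolding B_def
  proof (rule continuous_map_cases_le)
    show "continuous_map ?W euclideanreal (\<lambda>w. min (3 * snd w) (3 - 3 * snd w))"
      using ct by (auto simp: continuous_map_unit_real intro!: continuous_intros)
    show "continuous_map (subtopology ?W {w \<in> topspace ?W. 1 \<le> min (3 * snd w) (3 - 3 * snd w)}) X
        (\<lambda>w. \<Phi> (snd (fst w)) (turn_to (middle (snd w))))"
      by (rule continuous_map_from_subtopology[OF continuous_map_loop_at[OF c\<Phi> cm]])
    show "continuous_map (subtopology ?W {w \<in> topspace ?W. min (3 * snd w) (3 - 3 * snd w) \<le> 1}) X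
        (\<lambda>w. h (max (fst (fst w)) (detour (snd w)), snd (fst w)))"
      using continuous_map_compose[OF continuous_map_pairI[OF cmax cs] h]
      by (simp add: o_def continuous_map_from_subtopology)
    fix w assume w: "w \<in> topspace ?W" and eq: "1 = min (3 * snd w) (3 - 3 * snd w)"
    then have "detour (snd w) = 1" by (simp add: detour_def)
    moreover from eq have "snd w = 1/3 \<or> snd w = 2/3" by (auto simp: min_def split: if_splits)
    then have "middle (snd w) = 0 \<or> middle (snd w) = 1" by (auto simp: middle_def)
    ultimately show "\<Phi> (snd (fst w)) (turn_to (middle (snd w)))
        = h (max (fst (fst w)) (detour (snd w)), snd (fst w))"
      using w by (auto simp: turn_to_ends h1')
  qed simp
  have B_ends: "B r s 0 = h (r, s)" "B r s 1 = h (r, s)" if "r \<in> {0..1}" for r s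
    using that by (auto simp: B_def detour_middle_ends max_def)
  have Bb: "B r s t = x0" if "r \<in> {0..1}" "s \<in> cube_boundary n" "t \<in> {0..1}" for r s t
  proof -
    have "max r (detour t) \<in> {0..1}" using that(1) detour_unit[OF that(3)] by (simp add: max_def)
    then show ?thesis using that(2) by (simp add: B_def \<Phi>b hb)
  qed
  define b where "b = (\<lambda>s\<in>topspace (cube (Suc n)). B 0 (restrict s {..<n}) (s n))"
  have b: "b \<in> spheroids (Suc n) X x0"
    unfolding b_def
  proof (rule restrict_spheroid)
    have "continuous_map (cube (Suc n)) ?W (\<lambda>s. ((0, restrict s {..<n}), s n))"
      by (rule continuous_map_pairI[OF continuous_map_pairI[OF continuous_map_constI
              continuous_map_cube_init[OF continuous_map_id[unfolded id_def], unfolded Suc_eq_plus1[symmetric]]]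
            continuous_map_cube_coord]) auto
    from continuous_map_compose[OF this cB]
    show "continuous_map (cube (Suc n)) X (\<lambda>s. B 0 (restrict s {..<n}) (s n))" by (simp add: o_def)
    fix s assume s: "s \<in> cube_boundary (Suc n)"
    then have st: "s \<in> topspace (cube (Suc n))" using cube_boundary_subset by auto
    have sn: "s n \<in> {0..1}" using cube_coord[OF st] by simp
    from s show "B 0 (restrict s {..<n}) (s n) = x0"
    proof (cases rule: cube_boundary_cases)
      case 1 then show ?thesis using sn by (intro Bb) auto
    qed (use cube_init[OF st] in \<open>simp_all add: B_ends h0 const_map_def\<close>)
  qed
  \<comment> \<open>At \<open>r = 1\<close> nothing is left of the way out except a pause before and after the loop.\<close>
  let ?m = "\<lambda>s. loop_of (\<lambda>t. \<Phi> s (turn_to (middle t)))"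
  have "sph_homotopic n (loop_space X) ?c0 (loop_spheroid n b) ?m"
  proof (rule sph_homotopicI)
    show "continuous_map ?A (loop_space X) (\<lambda>a. loop_of (\<lambda>t. B (fst a) (snd a) t))"
      using continuous_map_loop_of[OF cB] by (auto simp: B_ends)
    fix s assume s: "s \<in> topspace (cube n)"
    have "b (s(n := turn_of z)) = B 0 s (turn_of z)" if "norm z = 1" for z
    proof -
      have "restrict (s(n := turn_of z)) {..<n} = s"
        using s by (auto simp: topspace_cube PiE_iff extensional_def fun_eq_iff)
      then show ?thesis using cube_append_turn[OF s that] by (simp add: b_def)
    qed
    then show "loop_of (\<lambda>t. B (fst (0, s)) (snd (0, s)) t) = loop_spheroid n b s"
      using s by (auto simp: loop_spheroid_def)
    have "B 1 s t = \<Phi> s (turn_to (middle t))" if "t \<in> {0..1}" for t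
    proof (cases "1 \<le> min (3 * t) (3 - 3 * t)")
      case False
      then have "detour t < 1" by (auto simp: detour_def)
      then have "middle t = 0 \<or> middle t = 1" using detour_or_middle[of t] by auto
      then show ?thesis
        using False \<open>detour t < 1\<close> s by (auto simp: B_def turn_to_ends h1' max_def)
    qed (simp add: B_def)
    then show "loop_of (\<lambda>t. B (fst (1, s)) (snd (1, s)) t) = ?m s"
      using turn_of(1) by (auto intro!: restrict_ext)
  next
    fix t s assume "t \<in> {0..1::real}" "s \<in> cube_boundary n"
    then show "loop_of (\<lambda>x. B (fst (t, s)) (snd (t, s)) x) = ?c0"
      using turn_of(1) by (auto simp: const_map_def Bb intro!: restrict_ext)
  qed
  moreover have "sph_homotopic n (loop_space X) ?c0 ?m \<Phi>"
  proof (rule sph_homotopicI)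
    let ?P = "\<lambda>w. \<Phi> (snd (fst w)) (turn_to ((1 - fst (fst w)) * middle (snd w) + fst (fst w) * snd w))"
    have "continuous_map ?W X ?P"
      by (rule continuous_map_loop_at[OF c\<Phi> continuous_map_unit_lerp[OF cl cm ct]])
    from continuous_map_loop_of[OF this]
    show "continuous_map ?A (loop_space X) (\<lambda>a. loop_of (\<lambda>t. ?P (a, t)))"
      by (simp add: detour_middle_ends turn_to_ends)
    fix s assume s: "s \<in> topspace (cube n)"
    show "loop_of (\<lambda>t. ?P ((0, s), t)) = ?m s" by simp
    have "\<Phi> s \<in> maps circle X" using spheroid_apply[OF \<Phi> s] by simp
    then show "loop_of (\<lambda>t. ?P ((1, s), t)) = \<Phi> s"
      using turn_of(2) by (auto simp: maps_def extensional_def fun_eq_iff)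
  next
    fix t s assume "t \<in> {0..1::real}" "s \<in> cube_boundary n"
    then show "loop_of (\<lambda>x. \<Phi> (snd (fst ((t, s), x)))
        (turn_to ((1 - fst (fst ((t, s), x))) * middle (snd ((t, s), x)) + fst (fst ((t, s), x)) * snd ((t, s), x)))) = ?c0"
      by (simp add: \<Phi>b const_map_def)
  qed
  ultimately have "sph_homotopic n (loop_space X) ?c0 (loop_spheroid n b) \<Phi>"
    by (rule homotopic_with_trans)
  with b show ?thesis by (rule that)
qed

text \<open>Dividing a class by the class of the constant loops at its moving base points leaves a class
  in the kernel of evaluation at 1. By exactness that class comes from based loops.\<close>

lemma loop_space_decomposition:
  assumes n: "n \<ge> 1" and x0: "x0 \<in> topspace X"
    and \<Phi>: "\<Phi> \<in> spheroids n (loop_space X) (const_map circle x0)"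
  obtains f b where "f \<in> spheroids n X x0" "b \<in> spheroids (Suc n) X x0"
    "htpy_class n (loop_space X) (const_map circle x0) \<Phi>
       = htpy_class n (loop_space X) (const_map circle x0) (push n (const_map circle) f)
           \<otimes>\<^bsub>homotopy_group n (loop_space X) (const_map circle x0)\<^esub>
         htpy_class n (loop_space X) (const_map circle x0) (loop_spheroid n b)"
proof -
  let ?L = "loop_space X" and ?c0 = "const_map circle x0"
  let ?G = "homotopy_group n ?L ?c0" and ?H = "homotopy_group n X x0"
  let ?cls = "htpy_class n ?L ?c0" and ?ev = "\<lambda>l :: complex \<Rightarrow> 'a. l 1"
  let ?e = "induced_hom n X x0 ?ev"
  have c0: "?c0 \<in> topspace ?L" using x0 by (simp add: const_map_in_maps)
  interpret G: group ?G by (rule homotopy_group_is_group[OF n c0])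
  interpret H: group ?H by (rule homotopy_group_is_group[OF n x0])
  interpret e: group_hom ?G ?H ?e
    by unfold_locales (rule induced_hom_in_hom[OF n continuous_map_base_point, where ?x0.0 = ?c0, OF base_point_const])
  have e_cls: "?e (?cls \<Psi>) = htpy_class n X x0 (push n ?ev \<Psi>)" if "\<Psi> \<in> spheroids n ?L ?c0" for \<Psi>
    by (rule induced_hom_htpy_class[OF n continuous_map_base_point, where ?x0.0 = ?c0,
          OF base_point_const that])
  note push_ev = push_spheroid[OF n continuous_map_base_point, where ?x0.0 = ?c0, OF base_point_const]
  define f where "f = push n ?ev \<Phi>"
  have f: "f \<in> spheroids n X x0"
    unfolding f_def by (rule push_ev[OF \<Phi>])
  let ?cf = "push n (const_map circle) f"
  have cf: "?cf \<in> spheroids n ?L ?c0" by (rule push_const_spheroid[OF n f])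
  have x: "?cls \<Phi> \<in> carrier ?G" and y: "?cls ?cf \<in> carrier ?G"
    using \<Phi> cf by (auto simp: homotopy_group_carrier)
  have "?e (?cls \<Phi>) = ?e (?cls ?cf)"
    by (simp add: e_cls \<Phi> cf base_point_push_const[OF f]) (simp add: f_def)
  then have k: "?e (inv\<^bsub>?G\<^esub> ?cls ?cf \<otimes>\<^bsub>?G\<^esub> ?cls \<Phi>) = \<one>\<^bsub>?H\<^esub>"
    using x y by simp
  have "inv\<^bsub>?G\<^esub> ?cls ?cf \<otimes>\<^bsub>?G\<^esub> ?cls \<Phi> \<in> carrier ?G" using x y by simp
  then obtain \<Psi> where \<Psi>: "\<Psi> \<in> spheroids n ?L ?c0"
    "inv\<^bsub>?G\<^esub> ?cls ?cf \<otimes>\<^bsub>?G\<^esub> ?cls \<Phi> = ?cls \<Psi>"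
    unfolding homotopy_group_carrier by blast
  have "htpy_class n X x0 (const_map (cube n) x0) = htpy_class n X x0 (push n ?ev \<Psi>)"
    using k unfolding \<Psi>(2) e_cls[OF \<Psi>(1)] by (simp add: homotopy_group_one)
  then have "sph_homotopic n X x0 (const_map (cube n) x0) (push n ?ev \<Psi>)"
    using const_spheroid[OF x0] push_ev[OF \<Psi>(1)]
    by (simp add: htpy_class_eq_iff)
  then obtain b where b: "b \<in> spheroids (Suc n) X x0"
    and bh: "sph_homotopic n ?L ?c0 (loop_spheroid n b) \<Psi>"
    by (rule loop_spheroid_exact[OF n \<Psi>(1)])
  have "?cls (loop_spheroid n b) = ?cls \<Psi>"
    using bh loop_spheroid_spheroid[OF n b] \<Psi>(1) by (simp add: htpy_class_eq_iff)
  then have "?cls \<Phi> = ?cls ?cf \<otimes>\<^bsub>?G\<^esub> ?cls (loop_spheroid n b)"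
    using x y unfolding \<Psi>(2)[symmetric] by (simp add: G.m_assoc[symmetric])
  with f b show ?thesis by (rule that)
qed

section \<open>The Gottlieb group of the null component\<close>

abbreviation eval_loop :: "'a topology \<Rightarrow> 'a \<Rightarrow> (complex \<Rightarrow> 'a \<Rightarrow> 'a) \<Rightarrow> complex \<Rightarrow> 'a" where
  "eval_loop Y y0 l \<equiv> restrict ((\<lambda>g. g y0) \<circ> l) (topspace circle)"

lemma continuous_map_eval_loop:
  "y0 \<in> topspace Y \<Longrightarrow>
     continuous_map (loop_space (map_space Y Y)) (loop_space Y) (eval_loop Y y0)"
  by (rule continuous_map_postcompose[OF circle_props(3,2) continuous_map_eval_at])

lemma eval_loop_const: "eval_loop Y y0 (const_map circle g) = const_map circle (g y0)"
  by (auto simp: const_map_def)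

lemma topspace_path_component_space:
  "topspace (path_component_space X x) = {y. path_component_of X x y}"
  using path_component_of_subset_topspace[of X x] by (auto simp: path_component_space_def)

lemma null_loop_space_maps: "l \<in> topspace (null_loop_space Y y0) \<Longrightarrow> l \<in> maps circle Y"
  by (simp add: null_loop_space_def path_component_space_def)

lemma const_map_null_loop:
  assumes "path_connected_space Y" "y0 \<in> topspace Y" "y \<in> topspace Y"
  shows "const_map circle y \<in> topspace (null_loop_space Y y0)"
proof -
  have "path_connectedin (loop_space Y) (const_map circle ` topspace Y)"
    using assms(1)
    by (intro path_connectedin_continuous_map_image[OF continuous_map_const_map])
       (simp add: path_connectedin_topspace)
  then have "path_component_of (loop_space Y) (const_map circle y0) (const_map circle y)"
    using assms(2,3) unfolding path_component_of by blast
  then show ?thesis by (simp add: null_loop_space_def topspace_path_component_space)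
qed

text \<open>The witness \<open>\<Phi> s z y\<close> is the value at \<open>z\<close> of the image of the constant loop at \<open>y\<close> under \<open>F s\<close>. Precomposing with
  the map from \<open>Y\<close> to the constant loops replaces the space of loops by the locally
  compact space \<open>Y\<close> as a domain, so that the adjoint becomes continuous. Path connectedness puts all
  constant loops into the null component.\<close>

lemma self_maps_of_loops_restrict_to_constants:
  fixes Y :: "'a topology"
  assumes Y: "path_connected_space Y" "locally_compact_space Y" "Hausdorff_space Y"
    and y0: "y0 \<in> topspace Y" and n: "n \<ge> 1"
    and F: "F \<in> spheroids n (map_space (null_loop_space Y y0) (null_loop_space Y y0))
              (id_map (null_loop_space Y y0))"
  shows "\<exists>\<Phi>\<in>spheroids n (loop_space (map_space Y Y)) (const_map circle (id_map Y)).
           push n (eval_loop Y y0) \<Phi> = push n (\<lambda>g. g (const_map circle y0)) F"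
proof -
  let ?Z = "null_loop_space Y y0" and ?c0 = "const_map circle y0"
  let ?M = "map_space Y Y"
  have c: "const_map circle y \<in> topspace ?Z" if "y \<in> topspace Y" for y
    by (rule const_map_null_loop[OF Y(1) y0 that])
  have c0: "?c0 \<in> topspace ?Z" by (rule c[OF y0])
  let ?\<Phi> = "\<lambda>s. \<lambda>z\<in>topspace circle. \<lambda>y\<in>topspace Y. F s (const_map circle y) z"
  have cc: "continuous_map Y ?Z (const_map circle)"
    using c continuous_map_const_map[of Y circle]
    unfolding null_loop_space_def path_component_space_def
    by (auto simp: continuous_map_in_subtopology)
  let ?W = "prod_topology (prod_topology (cube n) circle) Y"
  have p1: "continuous_map ?W (cube n) (\<lambda>w. fst (fst w))"
    and p2: "continuous_map ?W circle (\<lambda>w. snd (fst w))"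
    and p3: "continuous_map ?W Y snd"
    using continuous_map_compose[OF continuous_map_fst continuous_map_fst]
      continuous_map_compose[OF continuous_map_fst continuous_map_snd] continuous_map_snd
    by (auto simp: o_def)
  have "continuous_map (cube n) (map_space Y ?Z) (\<lambda>s. restrict (F s \<circ> const_map circle) (topspace Y))"
    using continuous_map_compose[OF spheroid_continuous[OF F] continuous_map_precompose[OF cc]]
    by (simp add: o_def)
  from continuous_map_evaluation[OF Y(2,3) continuous_map_compose[OF p1 this, unfolded o_def] p3]
  have "continuous_map ?W ?Z (\<lambda>w. restrict (\<lambda>x. F (fst (fst w)) (const_map circle x)) (topspace Y) (snd w))" .
  then have "continuous_map ?W ?Z (\<lambda>w. F (fst (fst w)) (const_map circle (snd w)))"
    by (rule continuous_map_eq) auto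
  then have "continuous_map ?W (loop_space Y) (\<lambda>w. F (fst (fst w)) (const_map circle (snd w)))"
    unfolding null_loop_space_def path_component_space_def by (simp add: continuous_map_in_subtopology)
  from continuous_map_evaluation[OF circle_props(3,2) this p2]
  have "continuous_map ?W Y (\<lambda>w. F (fst (fst w)) (const_map circle (snd w)) (snd (fst w)))" .
  from continuous_map_curry[OF continuous_map_curry[OF this]]
  have c\<Phi>: "continuous_map (cube n) (loop_space ?M) ?\<Phi>" by simp
  have \<Phi>b: "?\<Phi> s = const_map circle (id_map Y)" if "s \<in> cube_boundary n" for s
  proof -
    have "F s (const_map circle y) z = y" if "y \<in> topspace Y" "norm z = 1" for y z
      using spheroid_boundary[OF F \<open>s \<in> cube_boundary n\<close>] c[OF that(1)] that(2)
      by (simp add: id_map_def const_map_def)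
    then have "(\<lambda>y\<in>topspace Y. F s (const_map circle y) z) = id_map Y" if "norm z = 1" for z
      using that by (auto simp: id_map_def intro!: restrict_ext)
    then show ?thesis
      unfolding const_map_def[of circle "id_map Y"] by (intro restrict_ext) simp
  qed
  have "restrict ?\<Phi> (topspace (cube n)) \<in> spheroids n (loop_space ?M) (const_map circle (id_map Y))"
    using c\<Phi> \<Phi>b by (rule restrict_spheroid)
  moreover have "push n (eval_loop Y y0) (restrict ?\<Phi> (topspace (cube n))) = push n (\<lambda>g. g ?c0) F"
  proof (rule restrict_ext)
    fix s assume s: "s \<in> topspace (cube n)"
    have "F s ?c0 \<in> topspace ?Z"
      using spheroid_apply[OF F s] c0 maps_apply by fastforce
    then have "F s ?c0 \<in> extensional (sphere 0 1)"
      using null_loop_space_maps by (fastforce simp: maps_def)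
    then show "(eval_loop Y y0 \<circ> restrict ?\<Phi> (topspace (cube n))) s = ((\<lambda>g. g ?c0) \<circ> F) s"
      using s y0 by (auto simp: extensional_def fun_eq_iff)
  qed
  ultimately show ?thesis by blast
qed

text \<open>The witness \<open>F s\<close> sends a loop \<open>l\<close> to \<open>z \<mapsto> \<Phi> s z (l z)\<close>. This is continuous in \<open>s\<close>, \<open>l\<close> and \<open>z\<close>
  together, because evaluation is continuous for maps defined on \<open>Y\<close> or on the circle. The image of \<open>l\<close> stays in the
  component of \<open>l\<close>, since moving \<open>s\<close> to the boundary of the cube moves it back to \<open>l\<close>.\<close>

lemma loops_of_self_maps_act_on_loops:
  fixes Y :: "'a topology"
  assumes Y: "locally_compact_space Y" "Hausdorff_space Y"
    and y0: "y0 \<in> topspace Y" and n: "n \<ge> 1"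
    and \<Phi>: "\<Phi> \<in> spheroids n (loop_space (map_space Y Y)) (const_map circle (id_map Y))"
  shows "\<exists>F\<in>spheroids n (map_space (null_loop_space Y y0) (null_loop_space Y y0))
              (id_map (null_loop_space Y y0)).
           push n (eval_loop Y y0) \<Phi> = push n (\<lambda>g. g (const_map circle y0)) F"
proof -
  let ?Z = "null_loop_space Y y0" and ?c0 = "const_map circle y0"
  let ?M = "map_space Y Y"
  have c0: "?c0 \<in> topspace ?Z"
    using y0 by (simp add: null_loop_space_def topspace_path_component_space
        path_component_of_refl const_map_in_maps)
  let ?g = "\<lambda>p. \<lambda>z\<in>topspace circle. \<Phi> (fst p) z (snd p z)"
  let ?V = "prod_topology (cube n) ?Z"
  let ?W = "prod_topology ?V circle"
  have p1: "continuous_map ?W (cube n) (\<lambda>w. fst (fst w))"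
    and p2: "continuous_map ?W ?Z (\<lambda>w. snd (fst w))"
    and p3: "continuous_map ?W circle snd"
    using continuous_map_compose[OF continuous_map_fst continuous_map_fst]
      continuous_map_compose[OF continuous_map_fst continuous_map_snd] continuous_map_snd
    by (auto simp: o_def)
  have p2': "continuous_map ?W (loop_space Y) (\<lambda>w. snd (fst w))"
    using p2 unfolding null_loop_space_def path_component_space_def
    by (simp add: continuous_map_in_subtopology)
  have "continuous_map ?W ?M (\<lambda>w. \<Phi> (fst (fst w)) (snd w))"
    by (rule continuous_map_evaluation[OF circle_props(3,2)
          continuous_map_compose[OF p1 spheroid_continuous[OF \<Phi>], unfolded o_def] p3])
  from continuous_map_evaluation[OF Y this continuous_map_evaluation[OF circle_props(3,2) p2' p3]]
  have "continuous_map ?W Y (\<lambda>w. \<Phi> (fst (fst w)) (snd w) (snd (fst w) (snd w)))" .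
  from continuous_map_curry[OF this]
  have g: "continuous_map ?V (loop_space Y) ?g" by simp
  have gb: "?g (s, l) = l" if "s \<in> cube_boundary n" "l \<in> topspace ?Z" for s l
  proof -
    have l: "l \<in> maps circle Y" using that(2) by (rule null_loop_space_maps)
    have "\<Phi> s z (l z) = l z" if "norm z = 1" for z
      using maps_apply[OF l, of z] spheroid_boundary[OF \<Phi> \<open>s \<in> cube_boundary n\<close>] that
      by (simp add: const_map_def id_map_def)
    then show ?thesis using l by (auto simp: maps_def extensional_def fun_eq_iff)
  qed
  have "?g p \<in> topspace ?Z" if "p \<in> topspace ?V" for p
  proof -
    obtain s l where p: "p = (s, l)" and s: "s \<in> topspace (cube n)" and l: "l \<in> topspace ?Z"
      using \<open>p \<in> topspace ?V\<close> by (cases p) auto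
    have "continuous_map (cube n) ?V (\<lambda>s. (s, l))"
      using l by (intro continuous_map_pairI) auto
    from continuous_map_compose[OF this g]
    have "continuous_map (cube n) (loop_space Y) (\<lambda>s. ?g (s, l))" by (simp add: o_def)
    then have "path_component_of (loop_space Y) l (?g (s, l))"
      using gb[OF _ l] s by (rule path_component_of_spheroid[OF n])
    moreover have "path_component_of (loop_space Y) ?c0 l"
      using l by (simp add: null_loop_space_def topspace_path_component_space)
    ultimately have "path_component_of (loop_space Y) ?c0 (?g (s, l))"
      by (rule path_component_of_trans[rotated])
    then show ?thesis by (simp add: p null_loop_space_def topspace_path_component_space)
  qed
  then have "continuous_map ?V ?Z ?g"
    using g unfolding null_loop_space_def path_component_space_def
    by (auto simp: continuous_map_in_subtopology)
  from continuous_map_curry[OF this]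
  have F: "continuous_map (cube n) (map_space ?Z ?Z) (\<lambda>s. \<lambda>l\<in>topspace ?Z. ?g (s, l))" .
  let ?F = "\<lambda>s. \<lambda>l\<in>topspace ?Z. ?g (s, l)"
  have "restrict ?F (topspace (cube n)) \<in> spheroids n (map_space ?Z ?Z) (id_map ?Z)"
    using F by (rule restrict_spheroid) (use gb in \<open>auto simp: id_map_def intro!: restrict_ext\<close>)
  moreover have "push n (eval_loop Y y0) \<Phi> = push n (\<lambda>g. g ?c0) (restrict ?F (topspace (cube n)))"
    using c0 by (auto simp: const_map_def intro!: restrict_ext)
  ultimately show ?thesis by blast
qed

lemma gottlieb_null_loop_carrier:
  fixes Y :: "'a topology"
  assumes Y: "path_connected_space Y" "locally_compact_space Y" "Hausdorff_space Y"
    and y0: "y0 \<in> topspace Y" and n: "n \<ge> 1"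
  shows "carrier (gottlieb_group n (null_loop_space Y y0) (const_map circle y0)) =
    (\<lambda>\<Phi>. htpy_class n (loop_space Y) (const_map circle y0) (push n (eval_loop Y y0) \<Phi>))
      ` spheroids n (loop_space (map_space Y Y)) (const_map circle (id_map Y))"
    (is "_ = ?R")
proof -
  let ?Z = "null_loop_space Y y0" and ?c0 = "const_map circle y0"
  have c0: "?c0 \<in> topspace ?Z" by (rule const_map_null_loop[OF Y(1) y0 y0])
  have cls: "htpy_class n ?Z ?c0 = htpy_class n (loop_space Y) ?c0"
    unfolding null_loop_space_def by (rule htpy_class_path_component[OF n])
  have car: "carrier (gottlieb_group n ?Z ?c0) =
      (\<lambda>F. htpy_class n (loop_space Y) ?c0 (push n (\<lambda>g. g ?c0) F)) ` spheroids n (map_space ?Z ?Z) (id_map ?Z)"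
    using gottlieb_carrier[OF n c0] by (simp only: cls)
  show ?thesis
    unfolding car
  proof (intro equalityI image_subsetI)
    fix F assume "F \<in> spheroids n (map_space ?Z ?Z) (id_map ?Z)"
    from self_maps_of_loops_restrict_to_constants[OF Y y0 n this]
    obtain \<Phi> where \<Phi>: "\<Phi> \<in> spheroids n (loop_space (map_space Y Y)) (const_map circle (id_map Y))"
      "push n (eval_loop Y y0) \<Phi> = push n (\<lambda>g. g ?c0) F" by (elim bexE)
    show "htpy_class n (loop_space Y) ?c0 (push n (\<lambda>g. g ?c0) F) \<in> ?R"
      unfolding \<Phi>(2)[symmetric] using \<Phi>(1) by (rule imageI)
  next
    fix \<Phi> assume "\<Phi> \<in> spheroids n (loop_space (map_space Y Y)) (const_map circle (id_map Y))"
    from loops_of_self_maps_act_on_loops[OF Y(2,3) y0 n this]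
    obtain F where F: "F \<in> spheroids n (map_space ?Z ?Z) (id_map ?Z)"
      "push n (eval_loop Y y0) \<Phi> = push n (\<lambda>g. g ?c0) F" by (elim bexE)
    show "htpy_class n (loop_space Y) ?c0 (push n (eval_loop Y y0) \<Phi>)
        \<in> (\<lambda>F. htpy_class n (loop_space Y) ?c0 (push n (\<lambda>g. g ?c0) F)) ` spheroids n (map_space ?Z ?Z) (id_map ?Z)"
      unfolding F(2) using F(1) by (rule imageI)
  qed
qed

lemma push_eval_loop_const:
  "push n (eval_loop Y y0) (push n (const_map circle) f)
           = push n (const_map circle) (push n (\<lambda>g. g y0) f)"
  by (rule restrict_ext) (auto simp: const_map_def)

lemma push_eval_loop_loop_spheroid:
  "push n (eval_loop Y y0) (loop_spheroid n b) = loop_spheroid n (push (Suc n) (\<lambda>g. g y0) b)"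
  unfolding loop_spheroid_def
  by (rule restrict_ext) (auto intro!: restrict_ext simp: cube_append_turn)

lemma gottlieb_null_loop_iso:
  fixes Y :: "'a topology"
  assumes Y: "path_connected_space Y" "locally_compact_space Y" "Hausdorff_space Y"
    and y0: "y0 \<in> topspace Y" and n: "n \<ge> 1"
  shows "gottlieb_group n Y y0 \<times>\<times> gottlieb_group (Suc n) Y y0
           \<cong> gottlieb_group n (null_loop_space Y y0) (const_map circle y0)"
proof -
  let ?Z = "null_loop_space Y y0" and ?c0 = "const_map circle y0" and ?L = "loop_space Y"
  let ?M = "map_space Y Y" and ?ev = "\<lambda>g :: 'a \<Rightarrow> 'a. g y0" and ?id = "id_map Y"
  let ?P = "homotopy_group n ?L ?c0" and ?cls = "htpy_class n ?L ?c0"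
  let ?Q = "homotopy_group n Y y0" and ?R = "homotopy_group (Suc n) Y y0"
  let ?G = "gottlieb_group n ?Z ?c0"
  let ?A = "gottlieb_group n Y y0" and ?B = "gottlieb_group (Suc n) Y y0"
  have n': "Suc n \<ge> 1" by simp
  have c0Z: "?c0 \<in> topspace ?Z" by (rule const_map_null_loop[OF Y(1) y0 y0])
  have c0L: "?c0 \<in> topspace ?L" using y0 by (simp add: const_map_in_maps)
  have P_eq: "homotopy_group n ?Z ?c0 = ?P"
    unfolding null_loop_space_def by (rule homotopy_group_path_component[OF n])
  interpret G: comm_group ?G by (rule gottlieb_comm_group[OF n c0Z])
  interpret A: comm_group ?A by (rule gottlieb_comm_group[OF n y0])
  interpret B: comm_group ?B by (rule gottlieb_comm_group[OF n' y0])
  have multG: "x \<otimes>\<^bsub>?G\<^esub> y = x \<otimes>\<^bsub>?P\<^esub> y" for x y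
    unfolding gottlieb_mult P_eq ..
  have oneG: "\<one>\<^bsub>?G\<^esub> = \<one>\<^bsub>?P\<^esub>" unfolding gottlieb_one P_eq ..
  have A_sub: "carrier ?A \<subseteq> carrier ?Q" and B_sub: "carrier ?B \<subseteq> carrier ?R"
    using gottlieb_subgroup[OF n y0] gottlieb_subgroup[OF n' y0] by (auto simp: subgroup_def)

  define cst where "cst = induced_hom n ?L ?c0 (const_map circle)"
  define lp where "lp = class_op n ?L ?c0 (loop_spheroid n)"
  have cst_hom: "cst \<in> hom ?Q ?P"
    unfolding cst_def by (rule induced_hom_in_hom[OF n continuous_map_const_map refl])
  have lp_hom: "lp \<in> hom ?R ?P"
    unfolding lp_def by (rule class_op_hom[OF loop_spheroid_op[OF n] n' n])
  have cst_cls: "cst (htpy_class n Y y0 f) = ?cls (push n (const_map circle) f)"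
    if "f \<in> spheroids n Y y0" for f
    unfolding cst_def by (rule induced_hom_htpy_class[OF n continuous_map_const_map refl that])
  have lp_cls: "lp (htpy_class (Suc n) Y y0 b) = ?cls (loop_spheroid n b)"
    if "b \<in> spheroids (Suc n) Y y0" for b
    unfolding lp_def by (rule class_op_htpy_class[OF loop_spheroid_op[OF n] that])
  have ev: "push m ?ev f \<in> spheroids m Y y0" if "m \<ge> 1" "f \<in> spheroids m ?M ?id" for m f
    using push_spheroid[OF that(1) continuous_map_eval_at[OF y0], where ?x0.0 = ?id,
        OF eval_id_map[OF y0] that(2)] .
  note carG = gottlieb_null_loop_carrier[OF Y y0 n]

  have cst_G: "cst x \<in> carrier ?G" if x: "x \<in> carrier ?A" for x
  proof -
    obtain f where f: "f \<in> spheroids n ?M ?id" "x = htpy_class n Y y0 (push n ?ev f)"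
      using x unfolding gottlieb_carrier[OF n y0] by blast
    then have "cst x = ?cls (push n (eval_loop Y y0) (push n (const_map circle) f))"
      by (simp only: cst_cls[OF ev[OF n]] push_eval_loop_const)
    then show ?thesis
      unfolding carG using push_const_spheroid[OF n f(1)] by blast
  qed
  have lp_G: "lp x \<in> carrier ?G" if x: "x \<in> carrier ?B" for x
  proof -
    obtain b where b: "b \<in> spheroids (Suc n) ?M ?id" "x = htpy_class (Suc n) Y y0 (push (Suc n) ?ev b)"
      using x unfolding gottlieb_carrier[OF n' y0] by blast
    then have "lp x = ?cls (push n (eval_loop Y y0) (loop_spheroid n b))"
      by (simp only: lp_cls[OF ev[OF n']] push_eval_loop_loop_spheroid)
    then show ?thesis
      unfolding carG using loop_spheroid_spheroid[OF n b(1)] by blast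
  qed

  define \<Theta> where "\<Theta> = (\<lambda>(x, y). cst x \<otimes>\<^bsub>?G\<^esub> lp y)"
  have \<Theta>_hom: "\<Theta> \<in> hom (?A \<times>\<times> ?B) ?G"
  proof (rule homI)
    fix p assume "p \<in> carrier (?A \<times>\<times> ?B)"
    then show "\<Theta> p \<in> carrier ?G" by (auto simp: \<Theta>_def cst_G lp_G)
  next
    fix p q assume "p \<in> carrier (?A \<times>\<times> ?B)" "q \<in> carrier (?A \<times>\<times> ?B)"
    then obtain a b a' b' where p: "p = (a, b)" "a \<in> carrier ?A" "b \<in> carrier ?B"
      and q: "q = (a', b')" "a' \<in> carrier ?A" "b' \<in> carrier ?B" by auto
    have "cst (a \<otimes>\<^bsub>?A\<^esub> a') = cst a \<otimes>\<^bsub>?G\<^esub> cst a'"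
      unfolding gottlieb_mult[of n Y] multG using hom_mult[OF cst_hom] p(2) q(2) A_sub by blast
    moreover have "lp (b \<otimes>\<^bsub>?B\<^esub> b') = lp b \<otimes>\<^bsub>?G\<^esub> lp b'"
      unfolding gottlieb_mult[of "Suc n" Y] multG using hom_mult[OF lp_hom] p(3) q(3) B_sub by blast
    ultimately show "\<Theta> (p \<otimes>\<^bsub>?A \<times>\<times> ?B\<^esub> q) = \<Theta> p \<otimes>\<^bsub>?G\<^esub> \<Theta> q"
      using p q by (simp add: \<Theta>_def cst_G lp_G G.m_ac)
  qed
  interpret \<Theta>: group_hom "?A \<times>\<times> ?B" ?G \<Theta>
    by (intro group_hom.intro DirProd_group A.is_group B.is_group G.is_group
        group_hom_axioms.intro \<Theta>_hom)

  \<comment> \<open>The decomposition takes place over the self-maps of \<open>Y\<close>, so that evaluation at \<open>y0\<close> turns both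
     factors into Gottlieb elements.\<close>
  have surj: "carrier ?G \<subseteq> \<Theta> ` carrier (?A \<times>\<times> ?B)"
  proof
    fix x assume "x \<in> carrier ?G"
    then obtain \<Phi> where \<Phi>: "\<Phi> \<in> spheroids n (loop_space ?M) (const_map circle ?id)"
      and x: "x = ?cls (push n (eval_loop Y y0) \<Phi>)" unfolding carG by blast
    have idM: "?id \<in> topspace ?M" by (simp add: id_map_in_maps)
    let ?PM = "homotopy_group n (loop_space ?M) (const_map circle ?id)"
    let ?clsM = "htpy_class n (loop_space ?M) (const_map circle ?id)"
    from loop_space_decomposition[OF n idM \<Phi>] obtain f b where f: "f \<in> spheroids n ?M ?id"
      and b: "b \<in> spheroids (Suc n) ?M ?id"
      and dec: "?clsM \<Phi> = ?clsM (push n (const_map circle) f) \<otimes>\<^bsub>?PM\<^esub> ?clsM (loop_spheroid n b)" .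
    have elc: "eval_loop Y y0 (const_map circle ?id) = ?c0"
      by (simp only: eval_loop_const eval_id_map[OF y0])
    note W_hom = induced_hom_in_hom[OF n continuous_map_eval_loop[OF y0],
        where ?x0.0 = "const_map circle ?id", OF elc]
    note W_cls = induced_hom_htpy_class[OF n continuous_map_eval_loop[OF y0],
        where ?x0.0 = "const_map circle ?id", OF elc]
    note cf = push_const_spheroid[OF n f] and lb = loop_spheroid_spheroid[OF n b]
    have "x = induced_hom n ?L ?c0 (eval_loop Y y0) (?clsM \<Phi>)"
      by (simp only: x W_cls[OF \<Phi>])
    also have "\<dots> = induced_hom n ?L ?c0 (eval_loop Y y0) (?clsM (push n (const_map circle) f))
        \<otimes>\<^bsub>?P\<^esub> induced_hom n ?L ?c0 (eval_loop Y y0) (?clsM (loop_spheroid n b))"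
      unfolding dec using cf lb by (intro hom_mult[OF W_hom]) (auto simp: homotopy_group_carrier)
    also have "\<dots> = cst (htpy_class n Y y0 (push n ?ev f)) \<otimes>\<^bsub>?G\<^esub> lp (htpy_class (Suc n) Y y0 (push (Suc n) ?ev b))"
      by (simp only: W_cls[OF cf] W_cls[OF lb] push_eval_loop_const
          push_eval_loop_loop_spheroid cst_cls[OF ev[OF n f]] lp_cls[OF ev[OF n' b]] multG)
    also have "\<dots> = \<Theta> (htpy_class n Y y0 (push n ?ev f), htpy_class (Suc n) Y y0 (push (Suc n) ?ev b))"
      by (simp add: \<Theta>_def)
    finally show "x \<in> \<Theta> ` carrier (?A \<times>\<times> ?B)"
      using f b by (auto simp: gottlieb_carrier[OF n y0] gottlieb_carrier[OF n' y0])
  qed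
  \<comment> \<open>Evaluation of loops at 1 recovers the first factor, whence the second one is trivial too.\<close>
  have inj: "p = \<one>\<^bsub>?A \<times>\<times> ?B\<^esub>" if p: "p \<in> carrier (?A \<times>\<times> ?B)" "\<Theta> p = \<one>\<^bsub>?G\<^esub>" for p
  proof -
    obtain a b where ab: "p = (a, b)" "a \<in> carrier ?A" "b \<in> carrier ?B" using p(1) by auto
    obtain f where f: "f \<in> spheroids n Y y0" "a = htpy_class n Y y0 f"
      using ab(2) A_sub by (auto simp: homotopy_group_carrier)
    obtain g where g: "g \<in> spheroids (Suc n) Y y0" "b = htpy_class (Suc n) Y y0 g"
      using ab(3) B_sub by (auto simp: homotopy_group_carrier)
    let ?e = "induced_hom n Y y0 (\<lambda>l :: complex \<Rightarrow> 'a. l 1)"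
    note e_cls = induced_hom_htpy_class[OF n continuous_map_base_point, where ?x0.0 = ?c0,
        OF base_point_const]
    note e_hom = induced_hom_in_hom[OF n continuous_map_base_point, where ?x0.0 = ?c0,
        OF base_point_const]
    interpret e: group_hom ?P ?Q ?e
      by (intro group_hom.intro homotopy_group_is_group n c0L y0 group_hom_axioms.intro e_hom)
    note cf = push_const_spheroid[OF n f(1)] and lg = loop_spheroid_spheroid[OF n g(1)]
    have cst_a: "cst a = ?cls (push n (const_map circle) f)" unfolding f(2) by (rule cst_cls[OF f(1)])
    have lp_b: "lp b = ?cls (loop_spheroid n g)" unfolding g(2) by (rule lp_cls[OF g(1)])
    have in_P: "cst a \<in> carrier ?P" "lp b \<in> carrier ?P"
      unfolding cst_a lp_b using cf lg by (auto simp: homotopy_group_carrier)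
    have prod: "cst a \<otimes>\<^bsub>?P\<^esub> lp b = \<one>\<^bsub>?P\<^esub>" using p(2) by (simp add: ab(1) \<Theta>_def multG oneG)
    have e_lp: "?e (lp b) = \<one>\<^bsub>?Q\<^esub>"
      unfolding lp_b e_cls[OF lg] base_point_loop_spheroid[OF g(1)] homotopy_group_one ..
    have e_cst: "?e (cst a) = a"
      using e_cls[OF cf] by (simp only: cst_a base_point_push_const[OF f(1)] f(2)[symmetric])
    have "a \<otimes>\<^bsub>?Q\<^esub> \<one>\<^bsub>?Q\<^esub> = ?e (cst a \<otimes>\<^bsub>?P\<^esub> lp b)"
      using in_P by (simp add: e_lp e_cst)
    then have a: "a = \<one>\<^bsub>?Q\<^esub>"
      unfolding prod using ab(2) A_sub by auto
    have "cst a = \<one>\<^bsub>?P\<^esub>"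
      unfolding a using hom_one[OF cst_hom homotopy_group_is_group[OF n y0] e.G.is_group] .
    then have "lp b = \<one>\<^bsub>?P\<^esub>" using prod in_P by simp
    then have "sph_homotopic n ?L ?c0 (loop_spheroid n g) (const_map (cube n) ?c0)"
      unfolding lp_b homotopy_group_one
      by (subst (asm) htpy_class_eq_iff[OF lg const_spheroid[OF c0L]])
    then have "b = \<one>\<^bsub>?R\<^esub>"
      unfolding g(2) homotopy_group_one
      by (subst htpy_class_eq_iff[OF g(1) const_spheroid[OF y0]]) (rule loop_spheroid_inj[OF g(1)])
    with a show ?thesis by (simp add: ab(1) gottlieb_one)
  qed
  have "\<Theta> \<in> iso (?A \<times>\<times> ?B) ?G"
    unfolding \<Theta>.iso_iff using surj inj by blast
  then show ?thesis unfolding is_iso_def by blast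
qed

theorem theorem1:
  fixes Y :: "'a topology" and y0 :: 'a and n :: nat
  assumes "path_connected_space Y"
    and "locally_compact_space Y"
    and "Hausdorff_space Y"
    and "well_pointed Y y0"
    and "n \<ge> 1"
  shows "comm_group (gottlieb_group n (null_loop_space Y y0) (const_map circle y0)) \<and>
         comm_group (gottlieb_group n Y y0) \<and>
         comm_group (gottlieb_group (n + 1) Y y0) \<and>
         gottlieb_group n (null_loop_space Y y0) (const_map circle y0)
           \<cong> gottlieb_group n Y y0 \<times>\<times> gottlieb_group (n + 1) Y y0"
proof -
  have y0: "y0 \<in> topspace Y" using assms(4) by (simp add: well_pointed_def)
  have n': "n + 1 \<ge> 1" by simp
  have L: "comm_group (gottlieb_group n (null_loop_space Y y0) (const_map circle y0))"
    by (rule gottlieb_comm_group[OF assms(5) const_map_null_loop[OF assms(1) y0 y0]])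
  have Y: "comm_group (gottlieb_group n Y y0)" "comm_group (gottlieb_group (n + 1) Y y0)"
    by (rule gottlieb_comm_group[OF assms(5) y0], rule gottlieb_comm_group[OF n' y0])
  have "group (gottlieb_group n Y y0 \<times>\<times> gottlieb_group (n + 1) Y y0)"
    by (intro DirProd_group comm_group.axioms(2) Y)
  then have "gottlieb_group n (null_loop_space Y y0) (const_map circle y0)
      \<cong> gottlieb_group n Y y0 \<times>\<times> gottlieb_group (n + 1) Y y0"
    using gottlieb_null_loop_iso[OF assms(1-3) y0 assms(5)] unfolding Suc_eq_plus1 by (rule group.iso_sym)
  with L Y show ?thesis by blast
qed

end
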